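(* Fix $1 \leq p < \infty$, let $d\ge 1$ and suppose that $\varphi(z)=\sum_{j=1}^d c_j z_j$ with $c_1,\ldots,c_d\in\mathbb{C}$. Then $$\left(P\left(|\varphi|^{p-2} \varphi\right)\right)(z) = \frac{p}{2}\sum_{j=1}^d c_j z_j \int_0^1 \int_{\mathbb{T}^d} |\varphi_j(\zeta,r)|^{p-2}\,dm_d(\zeta)\,2r\,dr,$$ where $\varphi_j(z,r) := \varphi(z_1,\ldots,z_{j-1},r z_j,z_{j+1},\ldots,z_d)$ for $j=1,2,\ldots,d$.
   Context: $\mathbb{T}^d=\{z\in\mathbb{C}^d: |z_1|=\cdots=|z_d|=1\}$ with normalized Haar measure $m_d$. For $f\in L^1(\mathbb{T}^d)$ and $\alpha\in\mathbb{Z}^d$, $\widehat f(\alpha)=\int_{\mathbb{T}^d} f(z)\overline{z^\alpha}\,dm_d(z)$. $P$ is the Riesz projection, i.e. the orthogonal projection from $L^2(\mathbb{T}^d)$ onto $H^2(\mathbb{T}^d)=\{f\in L^2(\mathbb{T}^d):\widehat f(\alpha)=0 \text{ for all }\alpha\in\mathbb{Z}^d\setminus\mathbb{N}_0^d\}$, where $\mathbb{N}_0=\{0,1,2,\ldots\}$; thus $Pf$ has Fourier series $\sum_{\alpha\in\mathbb{N}_0^d}\widehat f(\alpha)z^\alpha$. The function $|\varphi|^{p-2}\varphi$ is understood to be $0$ where $\varphi=0$. *)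

theory Defs
  imports "HOL-Probability.Probability"
begin

text \<open>
  Normalized Haar measure on the unit circle, i.e. \<open>d\<theta> / (2 \<pi>)\<close> transported by
  \<open>\<theta> \<mapsto> exp (i \<theta>)\<close>; the underlying space is the circle itself.
\<close>
definition circle_haar :: "complex measure" where
  "circle_haar =
     distr (uniform_measure lborel {0..<2 * pi}) (restrict_space borel (sphere 0 1)) cis"

text \<open>
  Points of the \<open>d\<close>-torus are functions \<open>z\<close> with coordinates \<open>z 1, \<dots>, z d\<close>
  (and the dummy value \<^term>\<open>undefined\<close> at all other indices).
\<close>
definition torus_haar :: "nat \<Rightarrow> (nat \<Rightarrow> complex) measure" where
  "torus_haar d = PiM {1..d} (\<lambda>_. circle_haar)"

lemma space_torus_haar: "space (torus_haar d) = {1..d} \<rightarrow>\<^sub>E {z. cmod z = 1}"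
  by (auto simp: torus_haar_def circle_haar_def space_PiM space_restrict_space)

lemma prob_space_circle_haar: "prob_space circle_haar"
proof -
  have "prob_space (uniform_measure lborel {0..<2 * pi})"
    by (rule prob_space_uniform_measure) auto
  moreover have "cis \<in> uniform_measure lborel {0..<2 * pi} \<rightarrow>\<^sub>M restrict_space borel (sphere 0 1)"
  proof (rule measurable_restrict_space2)
    have "cis \<in> borel_measurable borel"
      by (intro borel_measurable_continuous_onI continuous_intros)
    then show "cis \<in> borel_measurable (uniform_measure lborel {0..<2 * pi})"
      by simp
  qed simp
  ultimately show ?thesis
    unfolding circle_haar_def by (rule prob_space.prob_space_distr)
qed

lemma prob_space_torus_haar: "prob_space (torus_haar d)"
  unfolding torus_haar_def by (intro prob_space_PiM prob_space_circle_haar)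

text \<open>Only the entries \<open>\<alpha> 1, \<dots>, \<alpha> d\<close> of a multi-index matter.\<close>
definition fourier_coeff :: "nat \<Rightarrow> ((nat \<Rightarrow> complex) \<Rightarrow> complex) \<Rightarrow> (nat \<Rightarrow> int) \<Rightarrow> complex" where
  "fourier_coeff d f \<alpha> = (LINT z|torus_haar d. f z * cnj (\<Prod>j=1..d. z j powi \<alpha> j))"

text \<open>Elements of \<open>L\<^sup>2\<close> are represented by functions, not by classes modulo null sets.\<close>
definition L2_torus :: "nat \<Rightarrow> ((nat \<Rightarrow> complex) \<Rightarrow> complex) set" where
  "L2_torus d = {f \<in> borel_measurable (torus_haar d).
                   integrable (torus_haar d) (\<lambda>z. (cmod (f z))\<^sup>2)}"

definition L2_inner ::
    "nat \<Rightarrow> ((nat \<Rightarrow> complex) \<Rightarrow> complex) \<Rightarrow> ((nat \<Rightarrow> complex) \<Rightarrow> complex) \<Rightarrow> complex" where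
  "L2_inner d f g = (LINT z|torus_haar d. f z * cnj (g z))"

definition H2_torus :: "nat \<Rightarrow> ((nat \<Rightarrow> complex) \<Rightarrow> complex) set" where
  "H2_torus d = {f \<in> L2_torus d. \<forall>\<alpha>. (\<exists>j\<in>{1..d}. \<alpha> j < 0) \<longrightarrow> fourier_coeff d f \<alpha> = 0}"

text \<open>
  The orthogonal projection of \<open>f \<in> L\<^sup>2\<close> onto \<open>H\<^sup>2\<close>. As \<open>L\<^sup>2\<close> consists of functions here, it is
  determined only up to a null set, and one representative is chosen; statements about it have
  to be made almost everywhere.
\<close>
definition riesz_projection ::
    "nat \<Rightarrow> ((nat \<Rightarrow> complex) \<Rightarrow> complex) \<Rightarrow> (nat \<Rightarrow> complex) \<Rightarrow> complex" where
  "riesz_projection d f =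
     (SOME g. g \<in> H2_torus d \<and> (\<forall>h\<in>H2_torus d. L2_inner d (\<lambda>z. f z - g z) h = 0))"

end

(*
  The function f = |phi|^(p-2) phi is bounded and homogeneous of degree one under rotations, so only
  the coordinates z_1, ..., z_d can survive in its projection. This is made precise by approximating
  f boundedly and pointwise by phi (|phi|^2 + e)^((p-2)/2) and this, uniformly, by functions
  phi Q(|phi|^2) with a polynomial Q; the latter are trigonometric polynomials with all frequencies of
  total degree one, and such a frequency is in N_0^d only if it is a unit vector.
  The coefficient of z_j comes from the Green formula on the disc for the variable z_j, applied to
  the smooth approximations. In the limit e -> 0, the formula bounds the area integrals uniformly, so
  Fatou's lemma gives integrability of |phi_j|^(p-2), which then dominates.
*)
theory Submission
  imports Defs
begin

section \<open>Green's formula on the disc\<close>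

text \<open>With \<open>a = (p - 2) / 2\<close>, the Wirtinger derivative of w |w|^(2a) is (1 + a)
  |w|^(2a), and \<open>1 + a = p / 2\<close>: this is the constant of the theorem. The weight
  \<open>2 * r\<close> is the density of normalized area in polar coordinates. The assumption
  \<open>1 \<le> p\<close> enters as \<open>a + 1/2 \<ge> 0\<close>, which makes f, of modulus
  |phi|^(p-1), bounded. The obstacle is p < 2. The inner integral can diverge for a single r: for p
  = 1 and phi = z_1 + z_2 it does so at r = 1. A Bochner integral of a non-integrable function is 0,
  so integrability in torus and radius jointly has to be proved, and the limit is taken on this
  product space. There the zeros of phi_j form a null set if c_j \<noteq> 0; if c_j = 0, then phi_j
  = phi does not depend on r, and this case is settled separately.\<close>

lemma space_circle_haar: "space circle_haar = sphere 0 1"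
  by (simp add: circle_haar_def space_restrict_space)

lemma sets_circle_haar [measurable_cong]: "sets circle_haar = sets (restrict_space borel (sphere 0 1))"
  by (simp add: circle_haar_def)

lemma measurable_cis_circle:
  "cis \<in> lborel \<rightarrow>\<^sub>M restrict_space borel (sphere 0 1)"
proof (rule measurable_restrict_space2)
  show "cis \<in> borel_measurable lborel"
    by simp (intro borel_measurable_continuous_onI continuous_intros)
qed simp

text \<open>Passes to a gauge integral over a compact interval, where the fundamental theorem of
  calculus and the interchange of continuous integrals are at hand. Closing the half-open interval
  adds a null point.\<close>

lemma integral_circle_haar:
  fixes g :: "complex \<Rightarrow> 'b::euclidean_space"
  assumes g: "continuous_on (sphere 0 1) g"
  shows "(LINT z|circle_haar. g z) = integral {0..2*pi} (\<lambda>t. g (cis t)) /\<^sub>R (2*pi)"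
proof -
  have gm: "g \<in> borel_measurable (restrict_space borel (sphere 0 1))"
    by (rule borel_measurable_continuous_on_restrict[OF g])
  have cm: "(\<lambda>t. g (cis t)) \<in> borel_measurable lborel"
    using measurable_compose[OF measurable_cis_circle gm] .
  have cont: "continuous_on A (\<lambda>t. g (cis t))" for A
    by (rule continuous_on_compose2[OF g]) (auto intro!: continuous_intros)
  have int: "set_integrable lborel {0..2*pi} (\<lambda>t. g (cis t))"
    by (rule borel_integrable_compact[unfolded set_integrable_def[symmetric]]) (auto intro: cont)
  have "(LINT z|circle_haar. g z) = (LINT t|uniform_measure lborel {0..<2*pi}. g (cis t))"
    unfolding circle_haar_def
    by (rule integral_distr[OF _ gm]) (use measurable_cis_circle in simp)
  also have "\<dots> = (LINT t|density lborel (\<lambda>t. ennreal (indicator {0..<2*pi} t / (2*pi))). g (cis t))"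
  proof -
    have "1 / ennreal (2*pi) = ennreal (1 / (2*pi))"
      using divide_ennreal[of 1 "2*pi"] by (simp only: ennreal_1) simp
    then have "indicator {0..<2*pi} t / emeasure lborel {0..<2*pi} = ennreal (indicator {0..<2*pi} t / (2*pi))" for t :: real
      by (auto simp: indicator_def simp del: ennreal_1)
    then show ?thesis unfolding uniform_measure_def by (simp only:)
  qed
  also have "\<dots> = (LINT t|lborel. (indicator {0..<2*pi} t / (2*pi)) *\<^sub>R g (cis t))"
    by (rule integral_density[OF cm]) auto
  also have "\<dots> = (LINT t|lborel. (1 / (2*pi)) *\<^sub>R (indicator {0..<2*pi} t *\<^sub>R g (cis t)))"
    by (rule Bochner_Integration.integral_cong) auto
  also have "\<dots> = (LINT t:{0..<2*pi}|lborel. g (cis t)) /\<^sub>R (2*pi)"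
    unfolding set_lebesgue_integral_def by (subst integral_scaleR_right) (simp only: inverse_eq_divide)
  also have "(LINT t:{0..<2*pi}|lborel. g (cis t)) = (LINT t:{0..2*pi}|lborel. g (cis t))"
    unfolding set_lebesgue_integral_def
    by (rule integral_cong_AE) (use cm in \<open>auto intro!: AE_I[of _ _ "{2*pi}"] simp: indicator_def\<close>)
  also have "\<dots> = integral {0..2*pi} (\<lambda>t. g (cis t))"
    by (rule set_borel_integral_eq_integral(2)[OF int])
  finally show ?thesis .
qed

text \<open>
  \<open>dreg e a\<close> is the Wirtinger derivative \<open>\<partial>/\<partial>w\<close> of the smooth function \<open>reg e a\<close>.
\<close>
definition reg :: "real \<Rightarrow> real \<Rightarrow> complex \<Rightarrow> complex" where
  "reg e a w = w * complex_of_real (((cmod w)\<^sup>2 + e) powr a)"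

definition dreg :: "real \<Rightarrow> real \<Rightarrow> complex \<Rightarrow> real" where
  "dreg e a w = ((cmod w)\<^sup>2 + e) powr a + a * (cmod w)\<^sup>2 * ((cmod w)\<^sup>2 + e) powr (a - 1)"

lemma continuous_on_cmod_powr [continuous_intros]:
  "e > 0 \<Longrightarrow> continuous_on A f \<Longrightarrow> continuous_on A (\<lambda>x. ((cmod (f x))\<^sup>2 + e) powr a)"
  by (intro continuous_intros) (auto, smt (verit) zero_le_power2)

lemma continuous_on_reg [continuous_intros]:
  "e > 0 \<Longrightarrow> continuous_on A f \<Longrightarrow> continuous_on A (\<lambda>x. reg e a (f x))"
  unfolding reg_def by (intro continuous_intros)

lemma continuous_on_dreg [continuous_intros]:
  "e > 0 \<Longrightarrow> continuous_on A f \<Longrightarrow> continuous_on A (\<lambda>x. dreg e a (f x))"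
  unfolding dreg_def by (intro continuous_intros)

text \<open>Stated along an arbitrary curve, so that one rule yields both the radial and the angular
  derivative in \<open>circle_green\<close>. The factor \<open>2 * (w' \<bullet> w x)\<close> is the
  derivative of |w|^2 along the curve.\<close>

lemma has_vector_derivative_reg:
  assumes e: "e > 0" and w: "(w has_vector_derivative w') (at x within S)"
  shows "((\<lambda>x. reg e a (w x)) has_vector_derivative
     w' * of_real (((cmod (w x))\<^sup>2 + e) powr a) +
     w x * of_real (a * ((cmod (w x))\<^sup>2 + e) powr (a - 1) * (2 * (w' \<bullet> w x)))) (at x within S)"
proof -
  have pos: "w x \<bullet> w x + e > 0" using e inner_ge_zero[of "w x"] by linarith
  have 1: "((\<lambda>x. w x \<bullet> w x) has_real_derivative 2 * (w' \<bullet> w x)) (at x within S)"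
    using has_derivative_inner[OF w[unfolded has_vector_derivative_def] w[unfolded has_vector_derivative_def]]
    unfolding has_field_derivative_def
    by (auto simp: inner_commute algebra_simps elim!: has_derivative_eq_rhs)
  have 2: "((\<lambda>x. (w x \<bullet> w x + e) powr a) has_real_derivative
        a * (w x \<bullet> w x + e) powr (a - 1) * (2 * (w' \<bullet> w x))) (at x within S)"
  proof (rule DERIV_chain2[where f = "\<lambda>z. z powr a" and g = "\<lambda>x. w x \<bullet> w x + e"])
    show "((\<lambda>x. w x \<bullet> w x + e) has_real_derivative 2 * (w' \<bullet> w x)) (at x within S)"
      by (rule DERIV_add[OF 1 DERIV_const, simplified])
  qed (rule has_real_derivative_powr[OF pos])
  have 3: "((\<lambda>x. complex_of_real ((w x \<bullet> w x + e) powr a)) has_vector_derivative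
      of_real (a * (w x \<bullet> w x + e) powr (a - 1) * (2 * (w' \<bullet> w x)))) (at x within S)"
    by (rule has_vector_derivative_of_real[OF 2])
  show ?thesis unfolding reg_def
    using has_vector_derivative_mult[OF w 3] by (simp add: power2_norm_eq_inner add_ac)
qed

text \<open>The map z |-> b + c z is holomorphic, so the chain rule gives c times
  \<open>dreg e a\<close> as the Wirtinger derivative of the composition. An affine argument is
  exactly what phi becomes when all coordinates but one are frozen.\<close>

lemma circle_green:
  assumes e: "e > 0"
  shows "(LINT z|circle_haar. reg e a (b + c * z) * cnj z) =
     c * of_real (integral {0..1} (\<lambda>r. (LINT z|circle_haar. dreg e a (b + c * (of_real r * z))) * (2 * r)))"
proof -
  \<comment> \<open>With \<open>G = reg e a \<circ> w\<close>, \<open>Hr\<close> is \<open>\<partial>\<^sub>r(r e\<^sup>-\<^sup>i\<^sup>t G)\<close>, \<open>Kt\<close> is \<open>\<partial>\<^sub>t(e\<^sup>-\<^sup>i\<^sup>t G)\<close>; the integral of \<open>Kt\<close>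
    over a period vanishes.\<close>
  define w where "w r t = b + c * (complex_of_real r * cis t)" for r t
  define P where "P r t = ((cmod (w r t))\<^sup>2 + e) powr a" for r t
  define Q where "Q r t = a * ((cmod (w r t))\<^sup>2 + e) powr (a - 1)" for r t
  define Hr where "Hr r t = reg e a (w r t) * cis (-t) + 
    ((c * cis t) * of_real (P r t) + w r t * of_real (Q r t * (2 * ((c * cis t) \<bullet> w r t)))) * (of_real r * cis (-t))" for r t
  define Kt where "Kt r t = reg e a (w r t) * (- \<i> * cis (-t)) + 
    ((c * of_real r * \<i> * cis t) * of_real (P r t) + w r t * of_real (Q r t * (2 * ((c * of_real r * \<i> * cis t) \<bullet> w r t)))) * cis (-t)" for r t
  have dcis: "(cis has_vector_derivative \<i> * cis t) (at t within S)" for t S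
    unfolding has_vector_derivative_def
    by (auto intro!: derivative_eq_intros simp: scaleR_conv_of_real)
  have dcism: "((\<lambda>t. cis (-t)) has_vector_derivative - \<i> * cis (-t)) (at t within S)" for t S
    unfolding has_vector_derivative_def
    by (auto intro!: derivative_eq_intros simp: scaleR_conv_of_real)
  have wr: "((\<lambda>r. w r t) has_vector_derivative c * cis t) (at r within S)" for r t S
    unfolding w_def by (auto intro!: derivative_eq_intros)
  have wt: "((\<lambda>t. w r t) has_vector_derivative c * of_real r * \<i> * cis t) (at t within S)" for r t S
    unfolding w_def by (auto intro!: derivative_eq_intros dcis)
  have dH: "((\<lambda>r. reg e a (w r t) * (of_real r * cis (-t))) has_vector_derivative Hr r t) (at r within S)" for r t S
  proof -
    have "((\<lambda>r. complex_of_real r * cis (-t)) has_vector_derivative cis (-t)) (at r within S)"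
      by (auto intro!: derivative_eq_intros)
    from has_vector_derivative_mult[OF has_vector_derivative_reg[OF e wr] this]
    show ?thesis by (simp add: Hr_def P_def Q_def)
  qed
  have dK: "((\<lambda>t. reg e a (w r t) * cis (-t)) has_vector_derivative Kt r t) (at t within S)" for r t S
    using has_vector_derivative_mult[OF has_vector_derivative_reg[OF e wt] dcism]
    by (simp add: Kt_def P_def Q_def)
  \<comment> \<open>In polar coordinates 2 r d/dz = e^(-it) (r d/dr - i d/dt); the two terms e^(-it)
    G produced by the product rule cancel.\<close>
  have key: "Hr r t - \<i> * Kt r t = c * of_real (2 * r * dreg e a (w r t))" for r t
  proof -
    \<comment> \<open>The derivatives of |w|^2 along the radius and along the circle are real inner
      products; this identity recombines them into a complex product.\<close>
    have in1: "complex_of_real (u \<bullet> v) - \<i> * complex_of_real ((\<i> * u) \<bullet> v) = u * cnj v" for u v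
      by (auto simp: complex_eq_iff inner_complex_def algebra_simps)
    have in2: "(c * of_real r * \<i> * cis t) \<bullet> w r t = r * ((\<i> * (c * cis t)) \<bullet> w r t)"
      by (simp add: inner_complex_def algebra_simps)
    have cc: "cis t * cis (-t) = 1" by (simp add: cis_mult)
    have "Hr r t - \<i> * Kt r t = 2 * of_real r * c * of_real (P r t) * (cis t * cis (-t)) +
      w r t * of_real (Q r t) * 2 * of_real r * cis (-t) *
      (of_real ((c * cis t) \<bullet> w r t) - \<i> * of_real ((\<i> * (c * cis t)) \<bullet> w r t))"
      unfolding Hr_def Kt_def in2 by (simp add: algebra_simps)
    also have "\<dots> = 2 * of_real r * c * of_real (P r t) * (cis t * cis (-t)) +
      (w r t * cnj (w r t)) * of_real (Q r t) * 2 * of_real r * c * (cis t * cis (-t))"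
      unfolding in1 by (simp add: algebra_simps)
    also have "\<dots> = c * of_real (2 * r * dreg e a (w r t))"
      unfolding cc complex_norm_square[symmetric] dreg_def P_def Q_def by (simp add: algebra_simps)
    finally show ?thesis .
  qed
  have contw: "continuous_on A (\<lambda>x. w (f x) (g x))" if "continuous_on A f" "continuous_on A g" for A :: "(real \<times> real) set" and f g
    unfolding w_def by (intro continuous_intros that)
  have contw': "continuous_on A (\<lambda>x. w r x)" for A r
    unfolding w_def by (intro continuous_intros)
  have contH: "continuous_on A (\<lambda>(t, r). Hr r t)" for A
    unfolding Hr_def P_def Q_def split_beta by (intro continuous_intros contw e)
  have contH': "continuous_on A (\<lambda>t. Hr r t)" for A r
    unfolding Hr_def P_def Q_def split_beta by (intro continuous_intros contw' e)
  have intK: "(Kt r has_integral 0) {0..2*pi}" for r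
  proof -
    have "w r (2*pi) = w r 0" by (simp add: w_def)
    then show ?thesis
    using fundamental_theorem_of_calculus[of 0 "2*pi" "\<lambda>t. reg e a (w r t) * cis (-t)" "Kt r"] dK
    by (simp add: cis_cnj[symmetric])
  qed
  \<comment> \<open>The factor \<open>of_real r\<close> removes the boundary term at the centre of
    the disc, so that only the circle contributes.\<close>
  have intH: "((\<lambda>r. Hr r t) has_integral reg e a (b + c * cis t) * cis (-t)) {0..1}" for t
    using fundamental_theorem_of_calculus[of 0 1 "\<lambda>r. reg e a (w r t) * (of_real r * cis (-t))" "\<lambda>r. Hr r t"] dH
    by (simp add: w_def)
  have "integral {0..2*pi} (\<lambda>t. reg e a (b + c * cis t) * cis (-t)) =
     integral {0..2*pi} (\<lambda>t. integral {0..1} (\<lambda>r. Hr r t))"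
    by (simp add: integral_unique[OF intH])
  also have "\<dots> = integral {0..1} (\<lambda>r. integral {0..2*pi} (\<lambda>t. Hr r t))"
    using integral_swap_continuous[where a=0 and b="2*pi" and c=0 and d=1, OF contH] by simp
  also have "\<dots> = integral {0..1} (\<lambda>r. integral {0..2*pi} (\<lambda>t. c * of_real (2 * r * dreg e a (w r t))))"
  proof (rule arg_cong[where f="integral {0..1}"], rule ext)
    fix r
    have "(Hr r has_integral integral {0..2*pi} (Hr r)) {0..2*pi}"
      by (intro integrable_integral integrable_continuous_real contH')
    from has_integral_diff[OF this has_integral_mult_right[OF intK[of r], of \<i>]]
    have "((\<lambda>t. c * of_real (2 * r * dreg e a (w r t))) has_integral integral {0..2*pi} (Hr r)) {0..2*pi}"
      unfolding key by simp
    then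
    show "integral {0..2*pi} (Hr r) = integral {0..2*pi} (\<lambda>t. c * of_real (2 * r * dreg e a (w r t)))"
      by (rule integral_unique[symmetric])
  qed
  also have "\<dots> = integral {0..1} (\<lambda>r. c * of_real (integral {0..2*pi} (\<lambda>t. dreg e a (w r t)) * (2 * r)))"
  proof (rule arg_cong[where f="integral {0..1}"], rule ext)
    fix r
    have "((\<lambda>t. dreg e a (w r t)) has_integral integral {0..2*pi} (\<lambda>t. dreg e a (w r t))) {0..2*pi}"
      by (intro integrable_integral integrable_continuous_real continuous_intros contw' e)
    then have "((\<lambda>t. c * of_real (2 * r * dreg e a (w r t))) has_integral 
        c * of_real (2 * r * integral {0..2*pi} (\<lambda>t. dreg e a (w r t)))) {0..2*pi}"
      by (intro has_integral_mult_right has_integral_of_real)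
    from integral_unique[OF this] show "integral {0..2*pi} (\<lambda>t. c * of_real (2 * r * dreg e a (w r t))) = c * of_real (integral {0..2*pi} (\<lambda>t. dreg e a (w r t)) * (2 * r))"
      by (simp only: mult_ac)
  qed
  also have "\<dots> = c * of_real (integral {0..1} (\<lambda>r. integral {0..2*pi} (\<lambda>t. dreg e a (w r t)) * (2 * r)))"
  proof -
    have "continuous_on ({0..1} \<times> cbox 0 (2*pi)) (\<lambda>(r, t). dreg e a (w r t))"
      unfolding split_beta by (intro continuous_intros contw e)
    from integral_continuous_on_param[OF this]
    have *: "continuous_on {0..1} (\<lambda>r. integral {0..2*pi} (\<lambda>t. dreg e a (w r t)))"
      by simp
    have "((\<lambda>r. integral {0..2*pi} (\<lambda>t. dreg e a (w r t)) * (2 * r)) has_integral 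
       integral {0..1} (\<lambda>r. integral {0..2*pi} (\<lambda>t. dreg e a (w r t)) * (2 * r))) {0..1}"
      by (intro integrable_integral integrable_continuous_real continuous_intros *)
    then show ?thesis
      by (intro integral_unique has_integral_mult_right has_integral_of_real)
  qed
  finally have main: "integral {0..2*pi} (\<lambda>t. reg e a (b + c * cis t) * cis (-t)) = \<dots>" .
  have c1: "(LINT z|circle_haar. reg e a (b + c * z) * cnj z) = 
     integral {0..2*pi} (\<lambda>t. reg e a (b + c * cis t) * cis (-t)) /\<^sub>R (2*pi)"
  proof -
    have "continuous_on (sphere 0 1) (\<lambda>z. reg e a (b + c * z) * cnj z)"
      by (intro continuous_intros e)
    from integral_circle_haar[OF this] show ?thesis
      by (simp only: cis_cnj)
  qed
  have c2: "(LINT z|circle_haar. dreg e a (b + c * (of_real r * z))) = 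
     integral {0..2*pi} (\<lambda>t. dreg e a (w r t)) / (2*pi)" for r
  proof -
    have "continuous_on (sphere 0 1) (\<lambda>z. dreg e a (b + c * (of_real r * z)))"
      by (intro continuous_intros e)
    from integral_circle_haar[OF this] show ?thesis
      by (simp only: w_def divide_inverse real_scaleR_def mult.commute)
  qed
  have "integral {0..1} (\<lambda>r. integral {0..2*pi} (\<lambda>t. dreg e a (w r t)) / (2*pi) * (2 * r)) =
     integral {0..1} (\<lambda>r. integral {0..2*pi} (\<lambda>t. dreg e a (w r t)) * (2 * r)) / (2*pi)"
    using integral_mult_left[of "{0..1}" "\<lambda>r. integral {0..2*pi} (\<lambda>t. dreg e a (w r t)) * (2 * r)" "1 / (2*pi)"]
    by (simp only: times_divide_eq_right times_divide_eq_left mult_1_right)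
  then show ?thesis
    unfolding c1 c2 main
    by (simp only: scaleR_conv_of_real divide_inverse of_real_mult mult_ac)
qed

section \<open>Characters and the Riesz projection\<close>

interpretation circle_haar: prob_space circle_haar
  by (rule prob_space_circle_haar)

interpretation torus_haar: prob_space "torus_haar d" for d
  by (rule prob_space_torus_haar)

interpretation circles: product_sigma_finite "\<lambda>_::nat. circle_haar"
  by (intro product_sigma_finite.intro circle_haar.sigma_finite_measure_axioms)

lemma measurable_circle_haar_id [measurable]: "(\<lambda>z. z) \<in> borel_measurable circle_haar"
  by (subst measurable_cong_sets[OF sets_circle_haar refl]) (auto intro: measurable_restrict_space1)

lemma measurable_torus_component:
  "j \<in> {1..d} \<Longrightarrow> (\<lambda>z. z j) \<in> borel_measurable (torus_haar d)"
  unfolding torus_haar_def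
  using measurable_compose[OF measurable_component_singleton[of j "{1..d}" "\<lambda>_. circle_haar"]
    measurable_circle_haar_id] by simp

lemma norm_torus_component: "z \<in> space (torus_haar d) \<Longrightarrow> j \<in> {1..d} \<Longrightarrow> cmod (z j) = 1"
  by (auto simp: space_torus_haar PiE_iff)

lemma measurable_power_int [measurable (raw)]:
  fixes f :: "'a \<Rightarrow> complex"
  shows "f \<in> borel_measurable M \<Longrightarrow> (\<lambda>x. f x powi k) \<in> borel_measurable M"
  by (cases "k \<ge> 0") (simp_all add: power_int_def)

lemma measurable_cnj [measurable (raw)]:
  "f \<in> borel_measurable M \<Longrightarrow> (\<lambda>x. cnj (f x)) \<in> borel_measurable M"
  by (rule measurable_compose[where N = borel])
    (auto intro!: borel_measurable_continuous_onI continuous_intros)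

section \<open>Orthonormality of the characters\<close>

lemma circle_haar_powi: "(LINT z|circle_haar. z powi k) = (if k = 0 then 1 else 0)"
proof (cases "k = 0")
  case True
  then show ?thesis by (simp add: circle_haar.prob_space)
next
  case False
  have "((\<lambda>t. cis (real_of_int k * t)) has_integral
      1 / (\<i> * of_int k) * cis (real_of_int k * (2*pi)) - 1 / (\<i> * of_int k) * cis (real_of_int k * 0)) {0..2*pi}"
  proof (rule fundamental_theorem_of_calculus)
    fix t
    have "((\<lambda>t. cis (real_of_int k * t)) has_vector_derivative (\<i> * of_int k) * cis (real_of_int k * t))
        (at t within {0..2*pi})"
      unfolding has_vector_derivative_def
      by (auto intro!: derivative_eq_intros simp: scaleR_conv_of_real mult_ac)
    from has_vector_derivative_mult_right[OF this, of "1 / (\<i> * of_int k)"]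
    show "((\<lambda>t. 1 / (\<i> * of_int k) * cis (real_of_int k * t)) has_vector_derivative cis (real_of_int k * t))
        (at t within {0..2*pi})"
      using False by simp
  qed simp
  moreover have "cis (real_of_int k * (2*pi)) = 1"
    using cis_multiple_2pi[of "of_int k"] by (simp add: mult_ac)
  ultimately have "integral {0..2*pi} (\<lambda>t. cis (real_of_int k * t)) = 0"
    by (simp add: integral_unique)
  moreover have "(LINT z|circle_haar. z powi k) = integral {0..2*pi} (\<lambda>t. cis t powi k) /\<^sub>R (2*pi)"
    by (rule integral_circle_haar) (auto intro!: continuous_intros)
  ultimately show ?thesis
    using False by (simp add: cis_power_int)
qed

definition character :: "nat \<Rightarrow> (nat \<Rightarrow> int) \<Rightarrow> (nat \<Rightarrow> complex) \<Rightarrow> complex" where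
  "character d \<alpha> z = (\<Prod>j=1..d. z j powi \<alpha> j)"

definition unit_index :: "nat \<Rightarrow> nat \<Rightarrow> int" where
  "unit_index j i = (if i = j then 1 else 0)"

text \<open>Through this identity Fourier coefficients inherit linearity and the limit theorem from
  \<open>L2_inner\<close>.\<close>

lemma fourier_coeff_eq_inner: "fourier_coeff d f \<alpha> = L2_inner d f (character d \<alpha>)"
  by (simp add: fourier_coeff_def L2_inner_def character_def)

lemma measurable_character: "character d \<alpha> \<in> borel_measurable (torus_haar d)"
  unfolding character_def
  by (intro borel_measurable_prod measurable_power_int measurable_torus_component)

lemma norm_character: "z \<in> space (torus_haar d) \<Longrightarrow> cmod (character d \<alpha> z) = 1"
  by (simp add: character_def prod_norm[symmetric] norm_power_int norm_torus_component)

lemma character_unit_index: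
  assumes "j \<in> {1..d}"
  shows "character d (unit_index j) z = z j"
proof -
  have "character d (unit_index j) z = (\<Prod>i=1..d. if i = j then z j else 1)"
    unfolding character_def unit_index_def by (intro prod.cong) auto
  then show ?thesis using assms by (simp add: prod.delta)
qed

lemma character_mult:
  assumes "z \<in> space (torus_haar d)"
  shows "character d \<alpha> z * character d \<beta> z = character d (\<lambda>j. \<alpha> j + \<beta> j) z"
  unfolding character_def prod.distrib[symmetric]
proof (intro prod.cong refl)
  fix j assume "j \<in> {1..d}"
  then have "z j \<noteq> 0" using norm_torus_component[OF assms] by fastforce
  then show "z j powi \<alpha> j * z j powi \<beta> j = z j powi (\<alpha> j + \<beta> j)"
    by (simp add: power_int_add)
qed

lemma cnj_character:
  assumes "z \<in> space (torus_haar d)"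
  shows "cnj (character d \<beta> z) = character d (\<lambda>j. - \<beta> j) z"
  unfolding character_def cnj_prod
proof (intro prod.cong refl)
  fix j assume "j \<in> {1..d}"
  then have n: "cmod (z j) = 1" using norm_torus_component[OF assms] by fastforce
  then have "cnj (z j) = inverse (z j)"
    by (simp add: inverse_complex_def complex_eq_iff cmod_def)
  then show "cnj (z j powi \<beta> j) = z j powi (- \<beta> j)"
    by (simp add: power_int_def)
qed

lemma integral_character:
  "(LINT z|torus_haar d. character d \<alpha> z) = (if \<forall>j\<in>{1..d}. \<alpha> j = 0 then 1 else 0)"
proof -
  have m: "(\<lambda>z. z powi k) \<in> borel_measurable circle_haar" for k :: int
    by measurable
  have i: "integrable circle_haar (\<lambda>z. z powi k)" for k :: int
    by (rule circle_haar.integrable_const_bound[of _ 1])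
      (use m in \<open>auto simp: space_circle_haar norm_power_int intro!: AE_I2\<close>)
  have "(LINT z|torus_haar d. character d \<alpha> z) = (\<Prod>j=1..d. LINT z|circle_haar. z powi \<alpha> j)"
    unfolding torus_haar_def character_def
    by (rule circles.product_integral_prod) (auto intro: i)
  also have "\<dots> = (if \<forall>j\<in>{1..d}. \<alpha> j = 0 then 1 else 0)"
    by (auto simp: circle_haar_powi)
  finally show ?thesis .
qed

lemma inner_character:
  "L2_inner d (character d \<alpha>) (character d \<beta>) = (if \<forall>j\<in>{1..d}. \<alpha> j = \<beta> j then 1 else 0)"
proof -
  have "L2_inner d (character d \<alpha>) (character d \<beta>) = (LINT z|torus_haar d. character d (\<lambda>j. \<alpha> j + - \<beta> j) z)"
    unfolding L2_inner_def
    by (intro Bochner_Integration.integral_cong) (simp_all add: cnj_character character_mult)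
  also have "\<dots> = (if \<forall>j\<in>{1..d}. \<alpha> j = \<beta> j then 1 else 0)"
    unfolding integral_character by auto
  finally show ?thesis .
qed

section \<open>Square-integrable functions on the torus\<close>

lemma L2_bounded:
  assumes "f \<in> borel_measurable (torus_haar d)" "\<And>z. z \<in> space (torus_haar d) \<Longrightarrow> cmod (f z) \<le> B"
  shows "f \<in> L2_torus d"
proof -
  have "integrable (torus_haar d) (\<lambda>z. (cmod (f z))\<^sup>2)"
    by (rule torus_haar.integrable_const_bound[of _ "B\<^sup>2"])
      (use assms in \<open>auto intro!: AE_I2 power_mono\<close>)
  then show ?thesis using assms by (auto simp: L2_torus_def)
qed

lemma L2_character: "character d \<alpha> \<in> L2_torus d"
  by (rule L2_bounded[of _ _ 1]) (auto simp: measurable_character norm_character)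

lemma L2_integrable_mult:
  assumes "f \<in> L2_torus d" "g \<in> L2_torus d"
  shows "integrable (torus_haar d) (\<lambda>z. f z * cnj (g z))"
proof (rule Bochner_Integration.integrable_bound)
  show "integrable (torus_haar d) (\<lambda>z. (cmod (f z))\<^sup>2 + (cmod (g z))\<^sup>2)"
    using assms by (auto simp: L2_torus_def)
  show "(\<lambda>z. f z * cnj (g z)) \<in> borel_measurable (torus_haar d)"
    using assms by (auto simp: L2_torus_def)
  have "a * b \<le> a\<^sup>2 + b\<^sup>2" if "a \<ge> 0" "b \<ge> 0" for a b :: real
    using sum_squares_bound[of a b] mult_nonneg_nonneg[OF that] by linarith
  then show "AE z in torus_haar d. norm (f z * cnj (g z)) \<le> norm ((cmod (f z))\<^sup>2 + (cmod (g z))\<^sup>2)"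
    by (simp add: norm_mult)
qed

lemma L2_add:
  assumes "f \<in> L2_torus d" "g \<in> L2_torus d"
  shows "(\<lambda>z. f z + g z) \<in> L2_torus d"
proof -
  have [measurable]: "f \<in> borel_measurable (torus_haar d)" "g \<in> borel_measurable (torus_haar d)"
    using assms by (auto simp: L2_torus_def)
  have "integrable (torus_haar d) (\<lambda>z. (cmod (f z + g z))\<^sup>2)"
  proof (rule Bochner_Integration.integrable_bound)
    show "integrable (torus_haar d) (\<lambda>z. 2 * (cmod (f z))\<^sup>2 + 2 * (cmod (g z))\<^sup>2)"
      using assms by (auto simp: L2_torus_def)
    have "(cmod (u + v))\<^sup>2 \<le> 2 * (cmod u)\<^sup>2 + 2 * (cmod v)\<^sup>2" for u v
    proof -
      have "(cmod (u + v))\<^sup>2 \<le> (cmod u + cmod v)\<^sup>2"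
        by (intro power_mono norm_triangle_ineq) auto
      also have "\<dots> \<le> 2 * (cmod u)\<^sup>2 + 2 * (cmod v)\<^sup>2"
        using sum_squares_bound[of "cmod u" "cmod v"] by (simp add: power2_sum)
      finally show ?thesis .
    qed
    then show "AE z in torus_haar d. norm ((cmod (f z + g z))\<^sup>2) \<le> norm (2 * (cmod (f z))\<^sup>2 + 2 * (cmod (g z))\<^sup>2)"
      by simp
  qed measurable
  then show ?thesis by (simp add: L2_torus_def)
qed

lemma L2_scale:
  assumes "f \<in> L2_torus d"
  shows "(\<lambda>z. k * f z) \<in> L2_torus d"
  using assms by (auto simp: L2_torus_def norm_mult power_mult_distrib)

lemma L2_inner_add:
  assumes "f \<in> L2_torus d" "g \<in> L2_torus d" "h \<in> L2_torus d"
  shows "L2_inner d (\<lambda>z. f z + g z) h = L2_inner d f h + L2_inner d g h"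
  unfolding L2_inner_def
  by (simp add: distrib_right L2_integrable_mult[OF assms(1,3)] L2_integrable_mult[OF assms(2,3)])

lemma L2_inner_scale: "L2_inner d (\<lambda>z. k * f z) h = k * L2_inner d f h"
  unfolding L2_inner_def by (simp add: mult.assoc)

lemma L2_diff:
  assumes "f \<in> L2_torus d" "g \<in> L2_torus d"
  shows "(\<lambda>z. f z - g z) \<in> L2_torus d"
  using L2_add[OF assms(1) L2_scale[OF assms(2), of "-1"]] by simp

lemma L2_inner_diff:
  assumes "f \<in> L2_torus d" "g \<in> L2_torus d" "h \<in> L2_torus d"
  shows "L2_inner d (\<lambda>z. f z - g z) h = L2_inner d f h - L2_inner d g h"
  using L2_inner_add[OF assms(1) L2_scale[OF assms(2), of "-1"] assms(3)]
  using L2_inner_scale[of d "-1" g h] by simp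

lemma L2_sum:
  assumes "\<And>i. i \<in> I \<Longrightarrow> f i \<in> L2_torus d"
  shows "(\<lambda>z. \<Sum>i\<in>I. f i z) \<in> L2_torus d"
  using assms
proof (induction I rule: infinite_finite_induct)
  case (insert i I)
  then show ?case using L2_add[of "f i" d] by simp
qed (auto simp: L2_torus_def)

lemma L2_inner_sum:
  assumes "\<And>i. i \<in> I \<Longrightarrow> f i \<in> L2_torus d" "h \<in> L2_torus d"
  shows "L2_inner d (\<lambda>z. \<Sum>i\<in>I. f i z) h = (\<Sum>i\<in>I. L2_inner d (f i) h)"
  unfolding L2_inner_def sum_distrib_right
  by (rule Bochner_Integration.integral_sum) (intro L2_integrable_mult assms)

lemma L2_inner_cnj: "L2_inner d g f = cnj (L2_inner d f g)"
proof -
  have eq: "(\<lambda>z. g z * cnj (f z)) = (\<lambda>z. cnj (f z * cnj (g z)))"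
    by (simp add: mult.commute)
  show ?thesis unfolding L2_inner_def eq by (rule Bochner_Integration.integral_cnj)
qed

lemma H2_subset_L2: "h \<in> H2_torus d \<Longrightarrow> h \<in> L2_torus d"
  by (simp add: H2_torus_def)

lemma H2_diff: "f \<in> H2_torus d \<Longrightarrow> g \<in> H2_torus d \<Longrightarrow> (\<lambda>z. f z - g z) \<in> H2_torus d"
  unfolding H2_torus_def
  by (auto simp: L2_diff fourier_coeff_eq_inner L2_inner_diff L2_character)

text \<open>Dominated convergence with majorant \<open>B * cmod (h z)\<close>. It is integrable
  because the constant 1 lies in L^2 of a probability space, and h is paired with it.\<close>

lemma L2_inner_LIMSEQ:
  assumes meas: "\<And>n. F n \<in> borel_measurable (torus_haar d)"
    and bound: "\<And>n z. z \<in> space (torus_haar d) \<Longrightarrow> cmod (F n z) \<le> B"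
    and lim: "\<And>z. z \<in> space (torus_haar d) \<Longrightarrow> (\<lambda>n. F n z) \<longlonglongrightarrow> f z"
    and h: "h \<in> L2_torus d"
  shows "(\<lambda>n. L2_inner d (F n) h) \<longlonglongrightarrow> L2_inner d f h"
  unfolding L2_inner_def
proof (rule integral_dominated_convergence[where w = "\<lambda>z. B * cmod (h z)"])
  have [measurable]: "f \<in> borel_measurable (torus_haar d)"
    by (rule borel_measurable_LIMSEQ_metric[OF meas lim])
  have [measurable]: "h \<in> borel_measurable (torus_haar d)"
    using h by (simp add: L2_torus_def)
  show "(\<lambda>z. f z * cnj (h z)) \<in> borel_measurable (torus_haar d)" by measurable
  show "(\<lambda>z. F n z * cnj (h z)) \<in> borel_measurable (torus_haar d)" for n
    using meas[of n] by measurable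
  have "(\<lambda>_. 1) \<in> L2_torus d" by (rule L2_bounded[of _ _ 1]) auto
  from L2_integrable_mult[OF h this]
  show "integrable (torus_haar d) (\<lambda>z. B * cmod (h z))" by auto
  show "AE z in torus_haar d. norm (F n z * cnj (h z)) \<le> B * cmod (h z)" for n
    by (intro AE_I2) (auto simp: norm_mult intro!: mult_right_mono bound)
  show "AE z in torus_haar d. (\<lambda>n. F n z * cnj (h z)) \<longlonglongrightarrow> f z * cnj (h z)"
    by (intro AE_I2 tendsto_intros lim)
qed

text \<open>
  For \<open>f\<close> in \<open>L\<^sup>2\<close> this says that the nonnegative Fourier coefficients of \<open>f\<close> live on the unit
  multi-indices, but in a weak form closed under bounded pointwise limits, so that
  completeness of the characters is never needed.
\<close>
definition degree_one_like :: "nat \<Rightarrow> ((nat \<Rightarrow> complex) \<Rightarrow> complex) \<Rightarrow> bool" where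
  "degree_one_like d f \<longleftrightarrow> f \<in> L2_torus d \<and>
     (\<forall>h\<in>H2_torus d. L2_inner d f h =
        (\<Sum>j=1..d. fourier_coeff d f (unit_index j) * cnj (fourier_coeff d h (unit_index j))))"

text \<open>For fixed h, both sides of the defining identity are finite combinations of inner
  products of f with fixed L^2 functions, so both pass to the limit. The limit is in L^2 because it
  inherits the bound B.\<close>

lemma degree_one_like_LIMSEQ:
  assumes good: "\<And>n. degree_one_like d (F n)"
    and bound: "\<And>n z. z \<in> space (torus_haar d) \<Longrightarrow> cmod (F n z) \<le> B"
    and lim: "\<And>z. z \<in> space (torus_haar d) \<Longrightarrow> (\<lambda>n. F n z) \<longlonglongrightarrow> f z"
  shows "degree_one_like d f"
  unfolding degree_one_like_def
proof (intro conjI ballI)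
  have meas: "F n \<in> borel_measurable (torus_haar d)" for n
    using good[of n] by (simp add: degree_one_like_def L2_torus_def)
  show "f \<in> L2_torus d"
  proof (rule L2_bounded)
    show "f \<in> borel_measurable (torus_haar d)"
      by (rule borel_measurable_LIMSEQ_metric[OF meas lim])
    show "cmod (f z) \<le> B" if "z \<in> space (torus_haar d)" for z
      by (rule LIMSEQ_le_const2[OF tendsto_norm[OF lim[OF that]]]) (use bound that in auto)
  qed
  fix h assume h: "h \<in> H2_torus d"
  have "(\<lambda>n. L2_inner d (F n) h) \<longlonglongrightarrow> L2_inner d f h"
    by (rule L2_inner_LIMSEQ[OF meas bound lim H2_subset_L2[OF h]])
  moreover have "(\<lambda>n. L2_inner d (F n) h) \<longlonglongrightarrow>
      (\<Sum>j=1..d. fourier_coeff d f (unit_index j) * cnj (fourier_coeff d h (unit_index j)))"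
  proof -
    have "L2_inner d (F n) h =
      (\<Sum>j=1..d. fourier_coeff d (F n) (unit_index j) * cnj (fourier_coeff d h (unit_index j)))" for n
      using good[of n] h by (simp add: degree_one_like_def)
    then show ?thesis
      unfolding fourier_coeff_eq_inner
      by (simp only:) (intro tendsto_intros L2_inner_LIMSEQ[OF meas bound lim L2_character])
  qed
  ultimately show "L2_inner d f h =
      (\<Sum>j=1..d. fourier_coeff d f (unit_index j) * cnj (fourier_coeff d h (unit_index j)))"
    by (rule LIMSEQ_unique)
qed

lemma L2_cong:
  assumes "f \<in> L2_torus d" "\<And>z. z \<in> space (torus_haar d) \<Longrightarrow> f z = g z"
  shows "g \<in> L2_torus d"
  using assms unfolding L2_torus_def
  by (auto cong: measurable_cong Bochner_Integration.integrable_cong)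

lemma L2_inner_cong:
  "(\<And>z. z \<in> space (torus_haar d) \<Longrightarrow> f z = g z) \<Longrightarrow> L2_inner d f h = L2_inner d g h"
  unfolding L2_inner_def by (rule Bochner_Integration.integral_cong) auto

lemma degree_one_like_cong:
  assumes "degree_one_like d f" "\<And>z. z \<in> space (torus_haar d) \<Longrightarrow> f z = g z"
  shows "degree_one_like d g"
  using assms(1) L2_cong[OF _ assms(2)] L2_inner_cong[of d f g, OF assms(2)]
  unfolding degree_one_like_def fourier_coeff_eq_inner by auto

lemma degree_one_like_add:
  assumes "degree_one_like d f" "degree_one_like d g"
  shows "degree_one_like d (\<lambda>z. f z + g z)"
  using assms unfolding degree_one_like_def fourier_coeff_eq_inner
  by (simp add: L2_add L2_inner_add L2_character H2_subset_L2 distrib_right sum.distrib)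

lemma degree_one_like_scale:
  assumes "degree_one_like d f"
  shows "degree_one_like d (\<lambda>z. k * f z)"
  using assms unfolding degree_one_like_def fourier_coeff_eq_inner
  by (simp add: L2_scale L2_inner_scale sum_distrib_left mult.assoc)

text \<open>If \<alpha> has a negative entry, the left side vanishes by the definition of H^2 and
  the right side by orthogonality. Otherwise \<alpha> consists of nonnegative integers with sum one,
  one entry takes the whole sum, and a single term survives on the right.\<close>

lemma degree_one_like_character:
  assumes sum: "(\<Sum>j=1..d. \<alpha> j) = 1"
  shows "degree_one_like d (character d \<alpha>)"
  unfolding degree_one_like_def
proof (intro conjI ballI L2_character)
  fix h assume h: "h \<in> H2_torus d"
  show "L2_inner d (character d \<alpha>) h = (\<Sum>j=1..d. fourier_coeff d (character d \<alpha>) (unit_index j) *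
      cnj (fourier_coeff d h (unit_index j)))"
  proof (cases "\<exists>j\<in>{1..d}. \<alpha> j < 0")
    case True
    then have "fourier_coeff d h \<alpha> = 0" using h by (auto simp: H2_torus_def)
    then have "L2_inner d (character d \<alpha>) h = 0"
      by (subst L2_inner_cnj) (simp add: fourier_coeff_eq_inner)
    moreover have "fourier_coeff d (character d \<alpha>) (unit_index j) = 0" for j
    proof -
      obtain i where i: "i \<in> {1..d}" "\<alpha> i < 0" using True by blast
      then have "\<alpha> i \<noteq> unit_index j i" by (auto simp: unit_index_def)
      then show ?thesis using i unfolding fourier_coeff_eq_inner inner_character by auto
    qed
    ultimately show ?thesis by simp
  next
    case False
    then have nonneg: "\<alpha> j \<ge> 0" if "j \<in> {1..d}" for j using that by force
    have "\<exists>i\<in>{1..d}. \<alpha> i \<noteq> 0"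
      using sum by (metis sum.neutral zero_neq_one)
    then obtain i where i: "i \<in> {1..d}" "\<alpha> i \<noteq> 0" by blast
    have split: "\<alpha> i + (\<Sum>j\<in>{1..d}-{i}. \<alpha> j) = 1"
      using sum i(1) by (simp add: sum.remove)
    have "(\<Sum>j\<in>{1..d}-{i}. \<alpha> j) \<ge> 0" by (intro sum_nonneg nonneg) auto
    then have \<alpha>i: "\<alpha> i = 1" and s0: "(\<Sum>j\<in>{1..d}-{i}. \<alpha> j) = 0"
      using split i nonneg[OF i(1)] by linarith+
    have "\<forall>j\<in>{1..d}-{i}. \<alpha> j = 0"
      using s0 by (subst (asm) sum_nonneg_eq_0_iff) (auto intro: nonneg)
    then have \<alpha>: "\<alpha> j = unit_index i j" if "j \<in> {1..d}" for j
      using \<alpha>i that by (auto simp: unit_index_def)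
    have ch: "character d \<alpha> = character d (unit_index i)"
      unfolding character_def by (intro ext prod.cong refl) (simp add: \<alpha>)
    have "fourier_coeff d (character d \<alpha>) (unit_index j) = (if j = i then 1 else 0)" if "j \<in> {1..d}" for j
      using that i(1) unfolding ch fourier_coeff_eq_inner inner_character
      by (auto simp: unit_index_def split: if_splits)
    then have "(\<Sum>j=1..d. fourier_coeff d (character d \<alpha>) (unit_index j) * cnj (fourier_coeff d h (unit_index j)))
       = (\<Sum>j=1..d. if j = i then cnj (fourier_coeff d h (unit_index j)) else 0)"
      by (intro sum.cong) auto
    also have "\<dots> = cnj (fourier_coeff d h (unit_index i))" using i(1) by simp
    also have "\<dots> = L2_inner d (character d \<alpha>) h"
      unfolding ch fourier_coeff_eq_inner by (rule L2_inner_cnj[symmetric])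
    finally show ?thesis by simp
  qed
qed

section \<open>Trigonometric polynomials of total degree one\<close>

text \<open>
  The rule \<open>cong\<close> is needed because the characters multiply correctly only on the torus.
\<close>
inductive_set degree_one_span :: "nat \<Rightarrow> ((nat \<Rightarrow> complex) \<Rightarrow> complex) set" for d where
  char: "(\<Sum>j=1..d. \<alpha> j) = 1 \<Longrightarrow> character d \<alpha> \<in> degree_one_span d"
| zero: "(\<lambda>_. 0) \<in> degree_one_span d"
| add: "f \<in> degree_one_span d \<Longrightarrow> g \<in> degree_one_span d \<Longrightarrow> (\<lambda>z. f z + g z) \<in> degree_one_span d"
| scale: "f \<in> degree_one_span d \<Longrightarrow> (\<lambda>z. k * f z) \<in> degree_one_span d"
| cong: "f \<in> degree_one_span d \<Longrightarrow> (\<And>z. z \<in> space (torus_haar d) \<Longrightarrow> f z = g z) \<Longrightarrow> g \<in> degree_one_span d"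

lemma degree_one_span_like: "f \<in> degree_one_span d \<Longrightarrow> degree_one_like d f"
proof (induction rule: degree_one_span.induct)
  case zero
  then show ?case
    by (auto simp: degree_one_like_def fourier_coeff_def L2_inner_def intro!: L2_bounded[of _ _ 0])
next
  case (cong f g)
  then show ?case by (blast intro: degree_one_like_cong)
qed (auto intro: degree_one_like_add degree_one_like_scale degree_one_like_character)

lemma degree_one_span_sum:
  "(\<And>i. i \<in> I \<Longrightarrow> f i \<in> degree_one_span d) \<Longrightarrow> (\<lambda>z. \<Sum>i\<in>I. f i z) \<in> degree_one_span d"
  by (induction I rule: infinite_finite_induct) (auto intro: degree_one_span.zero degree_one_span.add)

text \<open>Multiplication by z_i cnj(z_j) shifts frequencies by a difference of two unit vectors
  and so keeps the total degree. Since |phi|^2 is a combination of such products, the span absorbs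
  factors |phi|^2.\<close>

lemma degree_one_span_mult:
  assumes "f \<in> degree_one_span d" and ij: "i \<in> {1..d}" "j \<in> {1..d}"
  shows "(\<lambda>z. f z * (z i * cnj (z j))) \<in> degree_one_span d"
  using assms(1)
proof (induction rule: degree_one_span.induct)
  case (char \<alpha>)
  \<comment> \<open>The frequency is written with \<open>+ -\<close> so that it matches literally
    what \<open>cnj_character\<close> and \<open>character_mult\<close> produce.\<close>
  have "(\<Sum>k=1..d. \<alpha> k + (unit_index i k + - unit_index j k)) = 1"
    using ij char by (simp add: sum.distrib sum_negf sum_subtractf unit_index_def)
  from degree_one_span.char[OF this] show ?case
  proof (rule degree_one_span.cong)
    fix z assume z: "z \<in> space (torus_haar d)"
    have "character d \<alpha> z * (z i * cnj (z j)) =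
        character d \<alpha> z * (character d (unit_index i) z * cnj (character d (unit_index j) z))"
      using ij by (simp add: character_unit_index)
    then show "character d (\<lambda>k. \<alpha> k + (unit_index i k + - unit_index j k)) z = character d \<alpha> z * (z i * cnj (z j))"
      by (simp only: cnj_character[OF z] character_mult[OF z])
  qed
next
  case zero
  then show ?case by (simp add: degree_one_span.zero)
next
  case (add f g)
  then show ?case by (simp add: distrib_right degree_one_span.add)
next
  case (scale f k)
  then show ?case by (simp add: mult.assoc degree_one_span.scale)
next
  case (cong f g)
  then show ?case by (auto intro: degree_one_span.cong)
qed

text \<open>The explicit sum g satisfies the specification under \<open>SOME\<close>, so the chosen
  R satisfies it too. Then u = R - g lies in H^2 and is the difference of two residuals orthogonal
  to H^2, hence orthogonal to itself and zero almost everywhere.\<close>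

lemma riesz_projection_degree_one_like:
  assumes f: "degree_one_like d f"
  shows "AE z in torus_haar d. riesz_projection d f z = (\<Sum>j=1..d. fourier_coeff d f (unit_index j) * z j)"
proof -
  define g where "g z = (\<Sum>j=1..d. fourier_coeff d f (unit_index j) * character d (unit_index j) z)" for z
  define proj where "proj g \<longleftrightarrow> g \<in> H2_torus d \<and> (\<forall>h\<in>H2_torus d. L2_inner d (\<lambda>z. f z - g z) h = 0)" for g
  have fL2: "f \<in> L2_torus d" using f by (simp add: degree_one_like_def)
  have gL2: "g \<in> L2_torus d"
    unfolding g_def by (intro L2_sum L2_scale L2_character)
  have gh: "L2_inner d g h = (\<Sum>j=1..d. fourier_coeff d f (unit_index j) * cnj (fourier_coeff d h (unit_index j)))"
    if "h \<in> L2_torus d" for h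
    unfolding g_def using that
    by (subst L2_inner_sum)
      (auto simp: L2_scale L2_character L2_inner_scale fourier_coeff_eq_inner
         intro!: sum.cong intro: L2_inner_cnj)
  have "g \<in> H2_torus d"
    unfolding H2_torus_def
  proof (intro CollectI conjI gL2 allI impI)
    fix \<alpha> assume "\<exists>j\<in>{1..d}. \<alpha> j < (0::int)"
    then obtain i where i: "i \<in> {1..d}" "\<alpha> i < 0" by blast
    have "L2_inner d (character d \<alpha>) (character d (unit_index j)) = 0" for j
    proof -
      have "\<alpha> i \<noteq> unit_index j i" using i(2) by (auto simp: unit_index_def)
      then show ?thesis using i unfolding inner_character by auto
    qed
    then show "fourier_coeff d g \<alpha> = 0"
      by (simp add: fourier_coeff_eq_inner gh L2_character)
  qed
  moreover have "L2_inner d (\<lambda>z. f z - g z) h = 0" if h: "h \<in> H2_torus d" for h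
    using f h by (simp add: L2_inner_diff fL2 gL2 H2_subset_L2 gh degree_one_like_def)
  ultimately have g: "proj g" by (simp add: proj_def)
  define R where "R = riesz_projection d f"
  have R: "proj R"
    unfolding R_def riesz_projection_def proj_def[symmetric] by (rule someI[where P = proj, OF g])
  define u where "u z = R z - g z" for z
  have uH2: "u \<in> H2_torus d"
    unfolding u_def using R g by (intro H2_diff) (auto simp: proj_def)
  have "L2_inner d u u = L2_inner d (\<lambda>z. (f z - g z) - (f z - R z)) u"
    by (rule L2_inner_cong) (simp add: u_def)
  also have "\<dots> = 0"
    using R g uH2 H2_subset_L2[of R d]
    by (subst L2_inner_diff) (auto simp: proj_def fL2 gL2 L2_diff H2_subset_L2)
  finally have "(LINT z|torus_haar d. complex_of_real ((cmod (u z))\<^sup>2)) = 0"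
    unfolding L2_inner_def complex_norm_square .
  then have "(LINT z|torus_haar d. (cmod (u z))\<^sup>2) = 0"
    by (subst (asm) integral_complex_of_real) simp
  then have "AE z in torus_haar d. (cmod (u z))\<^sup>2 = 0"
    using H2_subset_L2[OF uH2] by (subst (asm) integral_nonneg_eq_0_iff_AE) (auto simp: L2_torus_def)
  then show ?thesis
  proof (eventually_elim)
    case (elim z)
    have "g z = (\<Sum>j=1..d. fourier_coeff d f (unit_index j) * z j)"
      unfolding g_def by (intro sum.cong) (simp_all only: character_unit_index)
    then show ?case using elim by (simp add: u_def R_def)
  qed
qed

section \<open>Powers of a linear form\<close>

locale linear_form =
  fixes d :: nat and c :: "nat \<Rightarrow> complex" and \<phi> :: "(nat \<Rightarrow> complex) \<Rightarrow> complex"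
  assumes \<phi>: "\<And>z. \<phi> z = (\<Sum>j=1..d. c j * z j)"
begin

definition M :: real where "M = (\<Sum>j=1..d. cmod (c j))"

lemma M_nonneg: "M \<ge> 0"
  by (simp add: M_def sum_nonneg)

text \<open>Formulated on the closed polydisc because \<open>\<psi>\<close> later moves one
  coordinate into the interior of the disc.\<close>

lemma norm_form: "(\<And>j. j \<in> {1..d} \<Longrightarrow> cmod (z j) \<le> 1) \<Longrightarrow> cmod (\<phi> z) \<le> M"
  unfolding \<phi> M_def
  by (rule order_trans[OF norm_sum sum_mono]) (auto simp: norm_mult mult_left_le)

lemma norm_form_torus: "z \<in> space (torus_haar d) \<Longrightarrow> cmod (\<phi> z) \<le> M"
  by (rule norm_form) (simp add: norm_torus_component)

lemma measurable_form [measurable]: "\<phi> \<in> borel_measurable (torus_haar d)"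
  unfolding \<phi>
  by (intro borel_measurable_sum borel_measurable_times measurable_torus_component) auto

lemma span_form: "\<phi> \<in> degree_one_span d"
proof -
  have "(\<lambda>z. c j * z j) \<in> degree_one_span d" if "j \<in> {1..d}" for j
  proof -
    have "(\<Sum>i=1..d. unit_index j i) = 1" using that by (simp add: unit_index_def)
    then have "(\<lambda>z. c j * character d (unit_index j) z) \<in> degree_one_span d"
      by (intro degree_one_span.scale degree_one_span.char)
    then show ?thesis by (simp only: character_unit_index[OF that])
  qed
  then have "(\<lambda>z. \<Sum>j=1..d. c j * z j) \<in> degree_one_span d"
    by (rule degree_one_span_sum)
  then show ?thesis by (simp only: \<phi>[symmetric])
qed

lemma span_form_power: "(\<lambda>z. \<phi> z * of_real (((cmod (\<phi> z))\<^sup>2) ^ n)) \<in> degree_one_span d"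
proof (induction n)
  case 0
  then show ?case by (simp add: span_form)
next
  case (Suc n)
  let ?f = "\<lambda>z. \<phi> z * complex_of_real (((cmod (\<phi> z))\<^sup>2) ^ n)"
  have "(\<lambda>z. \<Sum>i=1..d. \<Sum>j=1..d. (c i * cnj (c j)) * (?f z * (z i * cnj (z j)))) \<in> degree_one_span d"
    by (intro degree_one_span_sum degree_one_span.scale degree_one_span_mult Suc.IH) auto
  then show ?case
  proof (rule degree_one_span.cong)
    fix z
    have "complex_of_real ((cmod (\<phi> z))\<^sup>2) = (\<Sum>i=1..d. \<Sum>j=1..d. (c i * z i) * (cnj (c j) * cnj (z j)))"
      unfolding complex_norm_square sum_product[symmetric] by (simp add: \<phi>)
    then have "?f z * complex_of_real ((cmod (\<phi> z))\<^sup>2) =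
       (\<Sum>i=1..d. \<Sum>j=1..d. (c i * cnj (c j)) * (?f z * (z i * cnj (z j))))"
      by (simp only: sum_distrib_left) (intro sum.cong refl, simp only: mult_ac)
    then show "(\<Sum>i=1..d. \<Sum>j=1..d. (c i * cnj (c j)) * (?f z * (z i * cnj (z j)))) = 
      \<phi> z * of_real (((cmod (\<phi> z))\<^sup>2) ^ Suc n)"
      by (simp only: power_Suc of_real_mult mult_ac)
  qed
qed

text \<open>On the torus |phi|^2 stays in the compact interval [0, M^2], where Weierstrass
  approximation of q is available. Approximants within distance 1 of q share a bound, as
  \<open>degree_one_like_LIMSEQ\<close> requires.\<close>

lemma degree_one_like_continuous:
  fixes q :: "real \<Rightarrow> real"
  assumes q: "continuous_on {0..M\<^sup>2} q"
  shows "degree_one_like d (\<lambda>z. \<phi> z * of_real (q ((cmod (\<phi> z))\<^sup>2)))"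
proof -
  have "\<exists>g. real_polynomial_function g \<and> (\<forall>x\<in>{0..M\<^sup>2}. \<bar>q x - g x\<bar> < 1 / Suc n)" for n
    by (rule Stone_Weierstrass_real_polynomial_function[OF _ q, of "1 / Suc n"]) auto
  then obtain g where g: "\<And>n. real_polynomial_function (g n)"
     "\<And>n x. x \<in> {0..M\<^sup>2} \<Longrightarrow> \<bar>q x - g n x\<bar> < 1 / Suc n"
    by metis
  have "compact (q ` {0..M\<^sup>2})" by (intro compact_continuous_image q) auto
  then obtain B where B: "\<And>x. x \<in> {0..M\<^sup>2} \<Longrightarrow> \<bar>q x\<bar> \<le> B"
    by (force simp: bounded_iff dest!: compact_imp_bounded)
  have dom: "(cmod (\<phi> z))\<^sup>2 \<in> {0..M\<^sup>2}" if "z \<in> space (torus_haar d)" for z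
    using norm_form_torus[OF that] by (auto intro!: power_mono)
  show ?thesis
  proof (rule degree_one_like_LIMSEQ)
    fix n
    obtain a N where gn: "g n = (\<lambda>x. \<Sum>i\<le>N. a i * x ^ i)"
      using g(1)[of n] by (auto simp: real_polynomial_function_iff_sum)
    have "(\<lambda>z. \<Sum>i\<le>N. of_real (a i) * (\<phi> z * of_real (((cmod (\<phi> z))\<^sup>2) ^ i))) \<in> degree_one_span d"
      by (intro degree_one_span_sum degree_one_span.scale span_form_power)
    moreover have "(\<lambda>z. \<Sum>i\<le>N. of_real (a i) * (\<phi> z * of_real (((cmod (\<phi> z))\<^sup>2) ^ i))) =
        (\<lambda>z. \<phi> z * of_real (g n ((cmod (\<phi> z))\<^sup>2)))"
      unfolding gn of_real_sum of_real_mult sum_distrib_left by (intro ext sum.cong refl) (simp only: mult_ac)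
    ultimately show "degree_one_like d (\<lambda>z. \<phi> z * of_real (g n ((cmod (\<phi> z))\<^sup>2)))"
      using degree_one_span_like by simp
  next
    fix n z assume z: "z \<in> space (torus_haar d)"
    have "1 / real (Suc n) \<le> 1" by simp
    with g(2)[OF dom[OF z], of n] B[OF dom[OF z]] have "\<bar>g n ((cmod (\<phi> z))\<^sup>2)\<bar> \<le> B + 1"
      by linarith
    then show "cmod (\<phi> z * of_real (g n ((cmod (\<phi> z))\<^sup>2))) \<le> M * (B + 1)"
      using norm_form_torus[OF z] M_nonneg unfolding norm_mult norm_of_real by (intro mult_mono) auto
  next
    fix z assume z: "z \<in> space (torus_haar d)"
    have "(\<lambda>n. g n ((cmod (\<phi> z))\<^sup>2)) \<longlonglongrightarrow> q ((cmod (\<phi> z))\<^sup>2)"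
    proof (rule Lim_transform2[OF tendsto_const])
      show "(\<lambda>n. q ((cmod (\<phi> z))\<^sup>2) - g n ((cmod (\<phi> z))\<^sup>2)) \<longlonglongrightarrow> 0"
        by (rule Lim_null_comparison[OF _ LIMSEQ_inverse_real_of_nat])
          (use g(2)[OF dom[OF z]] in \<open>auto simp: inverse_eq_divide intro!: always_eventually less_imp_le\<close>)
    qed
    then show "(\<lambda>n. \<phi> z * of_real (g n ((cmod (\<phi> z))\<^sup>2))) \<longlonglongrightarrow> \<phi> z * of_real (q ((cmod (\<phi> z))\<^sup>2))"
      by (intro tendsto_intros)
  qed
qed

text \<open>For \<open>e > 0\<close> the power is continuous up to s = 0 even when the exponent is
  negative.\<close>

lemma degree_one_like_reg:
  assumes e: "e > 0"
  shows "degree_one_like d (\<lambda>z. reg e a (\<phi> z))"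
proof -
  have "continuous_on {0..M\<^sup>2} (\<lambda>s. (s + e) powr a)"
    using e by (intro continuous_intros) auto
  from degree_one_like_continuous[OF this] show ?thesis by (simp add: reg_def)
qed

end

section \<open>The radial variable, and estimates uniform in the regularisation\<close>

abbreviation unit_interval :: "real measure" where
  "unit_interval \<equiv> restrict_space lborel {0..1}"

interpretation unit_interval: prob_space unit_interval
  by standard (simp add: emeasure_restrict_space space_restrict_space)

interpretation circle_interval: pair_prob_space circle_haar unit_interval
  by unfold_locales

interpretation torus_interval: pair_prob_space "torus_haar d" unit_interval for d
  by unfold_locales

lemma integral_unit_interval:
  fixes f :: "real \<Rightarrow> real"
  shows "(LINT r|unit_interval. f r) = (LINT r:{0..1}|lborel. f r)"
  by (simp add: integral_restrict_space set_lebesgue_integral_def)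

text \<open>Bridges \<open>circle_green\<close>, which has a gauge integral in r, and Fubini's
  theorem, which speaks of Lebesgue integrals.\<close>

lemma integral_unit_interval_HK:
  fixes f :: "real \<Rightarrow> real"
  assumes "integrable unit_interval f"
  shows "(LINT r|unit_interval. f r) = integral {0..1} f"
proof -
  have "set_integrable lborel {0..1} f"
    using assms by (simp add: integrable_restrict_space set_integrable_def)
  then show ?thesis
    unfolding integral_unit_interval by (rule set_borel_integral_eq_integral)
qed

text \<open>The factored form makes the sign visible: for -1 \<le> a < 0 the second summand of
  \<open>dreg\<close> is nonpositive, yet the whole is nonnegative.\<close>

lemma dreg_eq:
  assumes "e > 0"
  shows "dreg e a w = ((cmod w)\<^sup>2 + e) powr (a - 1) * ((1 + a) * (cmod w)\<^sup>2 + e)"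
proof -
  have "(cmod w)\<^sup>2 + e > 0" using assms by (simp add: add_nonneg_pos)
  then have "((cmod w)\<^sup>2 + e) powr a = ((cmod w)\<^sup>2 + e) powr (a - 1) * ((cmod w)\<^sup>2 + e)"
    by (simp add: powr_diff)
  then show ?thesis unfolding dreg_def by (simp add: algebra_simps)
qed

lemma dreg_nonneg: "e > 0 \<Longrightarrow> a \<ge> -1 \<Longrightarrow> dreg e a w \<ge> 0"
  by (simp add: dreg_eq)

lemma powr_square: "x > 0 \<Longrightarrow> (x\<^sup>2) powr a = x powr (2 * a)" for x :: real
  by (simp add: powr_powr flip: powr_numeral)

text \<open>For a \<le> 0 the power decreases in its base, so dropping e gives the first summand;
  for a > 0 it increases, and the second summand bounds it. Adding the two gives one majorant
  independent of e.\<close>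

lemma dreg_le:
  assumes e: "0 < e" "e \<le> 1" and a: "a \<ge> -1" and w: "w \<noteq> 0" "cmod w \<le> M"
  shows "dreg e a w \<le> cmod w powr (2 * a) + (1 + a) * (M\<^sup>2 + 1) powr a"
proof -
  define s where "s = (cmod w)\<^sup>2"
  have s: "s > 0" "s \<le> M\<^sup>2" using w by (auto simp: s_def intro: power_mono)
  have pos: "s + e > 0" using s e by linarith
  have split: "(s + e) powr a = (s + e) powr (a - 1) * (s + e)"
    using pos by (simp add: powr_diff)
  have D: "dreg e a w = (s + e) powr (a - 1) * ((1 + a) * s + e)"
    using dreg_eq[OF e(1)] by (simp add: s_def)
  have sw: "s powr a = cmod w powr (2 * a)"
    unfolding s_def by (rule powr_square) (use w in simp)
  show ?thesis
  proof (cases "a \<le> 0")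
    case True
    have "(1 + a) * s \<le> s" using True s by (simp add: mult_le_cancel_right1)
    then have "dreg e a w \<le> (s + e) powr a"
      unfolding D split by (intro mult_left_mono) auto
    also have "\<dots> \<le> s powr a" using True s e by (intro powr_mono2') auto
    finally show ?thesis using a unfolding sw by (simp add: add_increasing2)
  next
    case False
    have "(1 + a) * s + e \<le> (1 + a) * (s + e)" using False e by (simp add: algebra_simps)
    then have "dreg e a w \<le> (s + e) powr (a - 1) * ((1 + a) * (s + e))"
      unfolding D by (intro mult_left_mono) auto
    also have "\<dots> = (1 + a) * (s + e) powr a" unfolding split by simp
    also have "\<dots> \<le> (1 + a) * (M\<^sup>2 + 1) powr a"
      using False s e by (intro mult_left_mono powr_mono2) auto
    finally show ?thesis by (simp add: add_increasing)
  qed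
qed

text \<open>The point \<open>w = 0\<close> is excluded because \<open>0 powr b = 0\<close>: for
  positive e the left side there is \<open>e n powr a\<close>, which does not tend to 0 when a \<le>
  0.\<close>

lemma dreg_LIMSEQ:
  assumes e: "e \<longlonglongrightarrow> 0" and w: "w \<noteq> 0"
  shows "(\<lambda>n. dreg (e n) a w) \<longlonglongrightarrow> (1 + a) * cmod w powr (2 * a)"
proof -
  have s: "(cmod w)\<^sup>2 > 0" using w by simp
  have lim: "(\<lambda>n. ((cmod w)\<^sup>2 + e n) powr b) \<longlonglongrightarrow> ((cmod w)\<^sup>2 + 0) powr b" for b
    using s by (intro tendsto_powr tendsto_add tendsto_const e) auto
  have "(\<lambda>n. dreg (e n) a w) \<longlonglongrightarrow> ((cmod w)\<^sup>2 + 0) powr a + a * (cmod w)\<^sup>2 * ((cmod w)\<^sup>2 + 0) powr (a - 1)"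
    unfolding dreg_def by (intro tendsto_add tendsto_mult tendsto_const lim)
  also have "((cmod w)\<^sup>2 + 0) powr a + a * (cmod w)\<^sup>2 * ((cmod w)\<^sup>2 + 0) powr (a - 1) = (1 + a) * ((cmod w)\<^sup>2) powr a"
    using s by (simp add: powr_diff algebra_simps)
  also have "\<dots> = (1 + a) * cmod w powr (2 * a)"
    using powr_square[of "cmod w" a] w by simp
  finally show ?thesis .
qed

text \<open>Here \<open>w = 0\<close> is no exception: the factor w makes both sides vanish, in
  accordance with the convention for |phi|^(p-2) phi at zeros of phi.\<close>

lemma reg_LIMSEQ:
  assumes e: "e \<longlonglongrightarrow> 0"
  shows "(\<lambda>n. reg (e n) a w) \<longlonglongrightarrow> of_real (cmod w powr (2 * a)) * w"
proof (cases "w = 0")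
  case False
  then have s: "(cmod w)\<^sup>2 > 0" by simp
  have "(\<lambda>n. reg (e n) a w) \<longlonglongrightarrow> w * of_real (((cmod w)\<^sup>2 + 0) powr a)"
    unfolding reg_def using s by (intro tendsto_powr tendsto_add tendsto_mult tendsto_of_real tendsto_const e) auto
  then show ?thesis using powr_square[of "cmod w" a] False by (simp add: mult.commute)
qed (simp add: reg_def)

text \<open>The factor |w| is at most (|w|^2 + e)^(1/2) and raises the exponent to a + 1/2 = (p -
  1)/2. Its nonnegativity makes the bound independent of e.\<close>

lemma norm_reg_le:
  assumes e: "0 < e" "e \<le> 1" and a: "a \<ge> -1/2" and w: "cmod w \<le> M"
  shows "cmod (reg e a w) \<le> (M\<^sup>2 + 1) powr (a + 1/2)"
proof -
  have s: "(cmod w)\<^sup>2 \<le> M\<^sup>2" using w by (auto intro: power_mono)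
  have pos: "(cmod w)\<^sup>2 + e > 0" using e by (simp add: add_nonneg_pos)
  have "cmod w \<le> sqrt ((cmod w)\<^sup>2 + e)"
    by (rule real_le_rsqrt) (use e in simp)
  then have "cmod (reg e a w) \<le> sqrt ((cmod w)\<^sup>2 + e) * ((cmod w)\<^sup>2 + e) powr a"
    unfolding reg_def norm_mult using pos by (intro mult_mono) auto
  also have "\<dots> = ((cmod w)\<^sup>2 + e) powr (a + 1/2)"
    using pos by (simp add: powr_add powr_half_sqrt mult.commute)
  also have "\<dots> \<le> (M\<^sup>2 + 1) powr (a + 1/2)"
    using a s e pos by (intro powr_mono2) auto
  finally show ?thesis .
qed

lemma measurable_dreg [measurable (raw)]:
  "e > 0 \<Longrightarrow> f \<in> borel_measurable N \<Longrightarrow> (\<lambda>x. dreg e a (f x)) \<in> borel_measurable N"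
  by (rule measurable_compose[where N = borel])
    (auto intro!: borel_measurable_continuous_onI continuous_intros)

text \<open>The constant K depends on e; it serves only for integrability at a fixed e, while
  \<open>dreg_le\<close> serves for the limit.\<close>

lemma dreg_bounded:
  assumes "e > 0"
  obtains K where "\<And>w. cmod w \<le> M \<Longrightarrow> \<bar>dreg e a w\<bar> \<le> K"
proof -
  have "compact (dreg e a ` cball 0 M)"
    by (intro compact_continuous_image continuous_intros assms) auto
  then obtain K where "\<forall>x\<in>dreg e a ` cball 0 M. norm x \<le> K"
    by (auto dest!: compact_imp_bounded simp: bounded_iff)
  then show thesis by (intro that[of K]) auto
qed

section \<open>Fourier coefficients of the regularised powers\<close>

context linear_form
begin

definition \<psi> :: "nat \<Rightarrow> (nat \<Rightarrow> complex) \<times> real \<Rightarrow> complex" where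
  "\<psi> j = (\<lambda>(\<zeta>, r). \<phi> (\<zeta>(j := of_real r * \<zeta> j)))"

lemma form_upd:
  assumes "j \<in> {1..d}"
  shows "\<phi> (\<zeta>(j := y)) = (\<Sum>i\<in>{1..d}-{j}. c i * \<zeta> i) + c j * y"
proof -
  have "(\<Sum>i\<in>{1..d}-{j}. c i * (\<zeta>(j := y)) i) = (\<Sum>i\<in>{1..d}-{j}. c i * \<zeta> i)"
    by (intro sum.cong) auto
  then show ?thesis unfolding \<phi> using assms by (subst sum.remove[of _ j]) auto
qed

text \<open>Replaces the function update by a measurable expression and shows that \<psi> is affine
  in r with slope c_j \<zeta>_j.\<close>

lemma \<psi>_eq: "j \<in> {1..d} \<Longrightarrow> \<psi> j (\<zeta>, r) = \<phi> \<zeta> + c j * (of_real r - 1) * \<zeta> j"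
  using form_upd[of j \<zeta> "\<zeta> j"] form_upd[of j \<zeta> "of_real r * \<zeta> j"] by (simp add: \<psi>_def algebra_simps)

lemma measurable_\<psi>:
  assumes j: "j \<in> {1..d}"
  shows "\<psi> j \<in> borel_measurable (torus_haar d \<Otimes>\<^sub>M unit_interval)"
proof -
  have [measurable]: "(\<lambda>z. z j) \<in> borel_measurable (torus_haar d)"
    by (rule measurable_torus_component[OF j])
  have [measurable]: "(\<lambda>r. complex_of_real r) \<in> borel_measurable unit_interval"
    by (rule measurable_restrict_space1) simp
  have "(\<lambda>(\<zeta>, r). \<phi> \<zeta> + c j * (of_real r - 1) * \<zeta> j) \<in> borel_measurable (torus_haar d \<Otimes>\<^sub>M unit_interval)"
    by measurable
  moreover have "\<psi> j = (\<lambda>(\<zeta>, r). \<phi> \<zeta> + c j * (of_real r - 1) * \<zeta> j)"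
    by (auto simp: \<psi>_eq[OF j])
  ultimately show ?thesis by simp
qed

lemma measurable_radius [measurable]:
  "(\<lambda>x. snd x) \<in> borel_measurable (N \<Otimes>\<^sub>M unit_interval)"
  by (rule measurable_compose[OF measurable_snd]) (auto intro: measurable_restrict_space1)

lemma norm_\<psi>:
  assumes "x \<in> space (torus_haar d \<Otimes>\<^sub>M unit_interval)"
  shows "cmod (\<psi> j x) \<le> M"
  using assms
  by (cases x) (auto simp: \<psi>_def space_pair_measure space_restrict_space norm_mult norm_torus_component intro!: norm_form)

lemma integrable_dreg_\<psi>:
  assumes e: "e > 0" and j: "j \<in> {1..d}"
  shows "integrable (torus_haar d \<Otimes>\<^sub>M unit_interval) (\<lambda>x. dreg e a (\<psi> j x) * (2 * snd x))"
proof -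
  obtain K where K: "\<And>w. cmod w \<le> M \<Longrightarrow> \<bar>dreg e a w\<bar> \<le> K"
    using dreg_bounded[OF e] by blast
  have [measurable]: "\<psi> j \<in> borel_measurable (torus_haar d \<Otimes>\<^sub>M unit_interval)"
    by (rule measurable_\<psi>[OF j])
  show ?thesis
  proof (rule torus_interval.integrable_const_bound[where B = "K * 2"])
    show "AE x in torus_haar d \<Otimes>\<^sub>M unit_interval. norm (dreg e a (\<psi> j x) * (2 * snd x)) \<le> K * 2"
    proof (rule AE_I2)
      fix x assume x: "x \<in> space (torus_haar d \<Otimes>\<^sub>M unit_interval)"
      then have "0 \<le> snd x" "snd x \<le> 1" by (auto simp: space_pair_measure space_restrict_space)
      with K[OF norm_\<psi>[OF x]] show "norm (dreg e a (\<psi> j x) * (2 * snd x)) \<le> K * 2"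
        unfolding real_norm_def abs_mult by (intro mult_mono) (auto intro: order_trans[OF abs_ge_zero])
    qed
    show "(\<lambda>x. dreg e a (\<psi> j x) * (2 * snd x)) \<in> borel_measurable (torus_haar d \<Otimes>\<^sub>M unit_interval)"
      using e by measurable
  qed
qed

text \<open>With all coordinates but the j-th frozen, phi is \<open>b x + c j * y\<close> and
  \<open>circle_green\<close> applies. The splitting of the torus is used twice: to peel off the
  j-th circle on the left, and to put it back around the radial integral V.\<close>

lemma fourier_coeff_reg:
  assumes e: "e > 0" and j: "j \<in> {1..d}"
  shows "fourier_coeff d (\<lambda>z. reg e a (\<phi> z)) (unit_index j) =
    c j * of_real (LINT x|(torus_haar d \<Otimes>\<^sub>M unit_interval). dreg e a (\<psi> j x) * (2 * snd x))"
proof -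
  define I where "I = {1..d} - {j}"
  define N where "N = Pi\<^sub>M I (\<lambda>_. circle_haar)"
  have I: "finite I" "j \<notin> I" "insert j I = {1..d}" using j by (auto simp: I_def)
  have torus: "torus_haar d = Pi\<^sub>M (insert j I) (\<lambda>_. circle_haar)"
    by (simp add: torus_haar_def I)
  define b where "b x = (\<Sum>i\<in>I. c i * x i)" for x
  have upd: "\<phi> (x(j := y)) = b x + c j * y" for x y
    using form_upd[OF j] by (simp add: b_def I_def)
  have fint: "integrable (torus_haar d) (\<lambda>z. reg e a (\<phi> z) * cnj (z j))"
  proof -
    have "(\<lambda>z. z j) \<in> L2_torus d"
      using L2_character[of d "unit_index j"] unfolding character_unit_index[OF j, abs_def] .
    then show ?thesis
      using degree_one_like_reg[OF e, of a] by (intro L2_integrable_mult) (auto simp: degree_one_like_def)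
  qed
  define V where "V \<zeta> = (LINT r|unit_interval. dreg e a (\<psi> j (\<zeta>, r)) * (2 * r))" for \<zeta>
  have Vint: "integrable (torus_haar d) V"
    using torus_interval.integrable_fst'[OF integrable_dreg_\<psi>[OF e j, of a]] by (simp add: V_def[abs_def])
  have circle: "(LINT y|circle_haar. reg e a (b x + c j * y) * cnj y) = c j * of_real (LINT y|circle_haar. V (x(j := y)))" for x
  proof -
    let ?g = "\<lambda>y r. dreg e a (b x + c j * (of_real r * y)) * (2 * r)"
    have gint: "integrable (circle_haar \<Otimes>\<^sub>M unit_interval) (case_prod ?g)"
    proof -
      \<comment> \<open>Here x is an arbitrary function, not a point of a torus, so the bound has to
        involve \<open>b x\<close> instead of \<open>M\<close>.\<close>
      obtain K where K: "\<And>w. cmod w \<le> cmod (b x) + cmod (c j) \<Longrightarrow> \<bar>dreg e a w\<bar> \<le> K"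
        using dreg_bounded[OF e] by blast
      have [measurable]: "(\<lambda>r. complex_of_real r) \<in> borel_measurable unit_interval" "(\<lambda>r. r) \<in> borel_measurable unit_interval"
        by (auto intro: measurable_restrict_space1)
      have [measurable]: "(\<lambda>x. fst x) \<in> borel_measurable (circle_haar \<Otimes>\<^sub>M unit_interval)"
        by (rule measurable_compose[OF measurable_fst measurable_circle_haar_id])
      show ?thesis
      proof (rule circle_interval.integrable_const_bound[where B = "K * 2"])
        show "AE p in circle_haar \<Otimes>\<^sub>M unit_interval. norm (case_prod ?g p) \<le> K * 2"
        proof (rule AE_I2)
          fix p assume "p \<in> space (circle_haar \<Otimes>\<^sub>M unit_interval)"
          then obtain y r where p: "p = (y, r)" "cmod y = 1" "0 \<le> r" "r \<le> 1"
            by (auto simp: space_pair_measure space_restrict_space space_circle_haar)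
          have "cmod (b x + c j * (of_real r * y)) \<le> cmod (b x) + cmod (c j)"
            using p by (intro order_trans[OF norm_triangle_ineq] add_left_mono) (simp add: norm_mult mult_left_le)
          from K[OF this] p show "norm (case_prod ?g p) \<le> K * 2"
            unfolding p case_prod_conv real_norm_def abs_mult by (intro mult_mono) (auto intro: order_trans[OF abs_ge_zero])
        qed
        have "(\<lambda>p. dreg e a (b x + c j * (of_real (snd p) * fst p)) * (2 * snd p)) \<in> borel_measurable (circle_haar \<Otimes>\<^sub>M unit_interval)"
          using e by measurable
        then show "case_prod ?g \<in> borel_measurable (circle_haar \<Otimes>\<^sub>M unit_interval)"
          by (simp add: split_beta')
      qed
    qed
    have "V (x(j := y)) = (LINT r|unit_interval. ?g y r)" for y
    proof -
      have "b (x(j := y)) = b x" unfolding b_def using I(2) by (intro sum.cong) auto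
      then show ?thesis unfolding V_def \<psi>_def by (simp add: upd)
    qed
    then have "(LINT y|circle_haar. V (x(j := y))) = (LINT r|unit_interval. (LINT y|circle_haar. ?g y r))"
      using circle_interval.Fubini_integral[OF gint] by simp
    also have "\<dots> = integral {0..1} (\<lambda>r. (LINT y|circle_haar. ?g y r))"
      by (rule integral_unit_interval_HK[OF circle_interval.integrable_snd[OF gint]])
    also have "\<dots> = integral {0..1} (\<lambda>r. (LINT y|circle_haar. dreg e a (b x + c j * (of_real r * y))) * (2 * r))"
      by simp
    finally show ?thesis unfolding circle_green[OF e] by (simp only:)
  qed
  have "fourier_coeff d (\<lambda>z. reg e a (\<phi> z)) (unit_index j) = (LINT z|torus_haar d. reg e a (\<phi> z) * cnj (z j))"
    unfolding fourier_coeff_eq_inner L2_inner_def by (simp only: character_unit_index[OF j])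
  also have "\<dots> = (LINT x|N. LINT y|circle_haar. reg e a (b x + c j * y) * cnj y)"
    using circles.product_integral_insert[OF I(1,2) fint[unfolded torus]] unfolding torus N_def
    by (simp only: upd fun_upd_same)
  also have "\<dots> = c j * of_real (LINT x|N. LINT y|circle_haar. V (x(j := y)))"
    unfolding circle by simp
  also have "(LINT x|N. LINT y|circle_haar. V (x(j := y))) = (LINT z|torus_haar d. V z)"
    using circles.product_integral_insert[OF I(1,2) Vint[unfolded torus]] unfolding torus N_def by simp
  also have "\<dots> = (LINT x|(torus_haar d \<Otimes>\<^sub>M unit_interval). dreg e a (\<psi> j x) * (2 * snd x))"
    using torus_interval.integral_fst'[OF integrable_dreg_\<psi>[OF e j, of a]] by (simp add: V_def[abs_def])
  finally show ?thesis .
qed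

text \<open>On each radius \<psi> is affine with nonzero slope, so it has at most one zero, and
  Fubini makes the zero set null.\<close>

lemma AE_\<psi>_nonzero:
  assumes j: "j \<in> {1..d}" and c: "c j \<noteq> 0"
  shows "AE x in torus_haar d \<Otimes>\<^sub>M unit_interval. \<psi> j x \<noteq> 0"
proof (rule torus_interval.AE_pair_measure)
  have [measurable]: "\<psi> j \<in> borel_measurable (torus_haar d \<Otimes>\<^sub>M unit_interval)"
    by (rule measurable_\<psi>[OF j])
  show "{x \<in> space (torus_haar d \<Otimes>\<^sub>M unit_interval). \<psi> j x \<noteq> 0} \<in> sets (torus_haar d \<Otimes>\<^sub>M unit_interval)"
    by measurable
  show "AE \<zeta> in torus_haar d. AE r in unit_interval. \<psi> j (\<zeta>, r) \<noteq> 0"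
  proof (rule AE_I2)
    fix \<zeta> assume "\<zeta> \<in> space (torus_haar d)"
    then have z: "\<zeta> j \<noteq> 0" using norm_torus_component[OF _ j] by fastforce
    \<comment> \<open>The complex root need not be real; if some real r is a root, it equals the
      real part.\<close>
    define r0 where "r0 = Re (1 - \<phi> \<zeta> / (c j * \<zeta> j))"
    have "\<psi> j (\<zeta>, r) \<noteq> 0" if "r \<noteq> r0" for r
    proof
      assume "\<psi> j (\<zeta>, r) = 0"
      then have "complex_of_real r = 1 - \<phi> \<zeta> / (c j * \<zeta> j)"
        using z c unfolding \<psi>_eq[OF j] by (simp add: field_simps)
      then have "r = r0" unfolding r0_def by (metis Re_complex_of_real)
      with that show False by simp
    qed
    moreover have "AE r in unit_interval. r \<noteq> r0"
      by (subst AE_restrict_space_iff) (auto intro: eventually_mono[OF AE_lborel_singleton[of r0]])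
    ultimately show "AE r in unit_interval. \<psi> j (\<zeta>, r) \<noteq> 0" by auto
  qed
qed

section \<open>Removing the regularisation\<close>

definition power_form :: "real \<Rightarrow> (nat \<Rightarrow> complex) \<Rightarrow> complex" where
  "power_form p z = of_real (cmod (\<phi> z) powr (p - 2)) * \<phi> z"

text \<open>The parameter 1/(n+1) stays in (0, 1], the range in which \<open>norm_reg_le\<close> and
  \<open>dreg_le\<close> are uniform.\<close>

definition reg_seq :: "real \<Rightarrow> nat \<Rightarrow> (nat \<Rightarrow> complex) \<Rightarrow> complex" where
  "reg_seq p n z = reg (1 / Suc n) ((p - 2) / 2) (\<phi> z)"

lemma degree_one_like_reg_seq: "degree_one_like d (reg_seq p n)"
  unfolding reg_seq_def[abs_def] by (rule degree_one_like_reg) simp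

lemma reg_seq_bound:
  assumes "1 \<le> p" "z \<in> space (torus_haar d)"
  shows "cmod (reg_seq p n z) \<le> (M\<^sup>2 + 1) powr ((p - 2) / 2 + 1/2)"
  unfolding reg_seq_def using assms by (intro norm_reg_le norm_form_torus) auto

lemma one_over_Suc_LIMSEQ: "(\<lambda>n. 1 / real (Suc n)) \<longlonglongrightarrow> 0"
  using LIMSEQ_inverse_real_of_nat by (simp add: inverse_eq_divide)

lemma reg_seq_LIMSEQ: "(\<lambda>n. reg_seq p n z) \<longlonglongrightarrow> power_form p z"
proof -
  have "2 * ((p - 2) / 2) = p - 2" by simp
  then show ?thesis
    using reg_LIMSEQ[OF one_over_Suc_LIMSEQ, of "(p - 2) / 2" "\<phi> z"]
    by (simp only: reg_seq_def power_form_def)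
qed

lemma degree_one_like_power_form: "1 \<le> p \<Longrightarrow> degree_one_like d (power_form p)"
  by (rule degree_one_like_LIMSEQ[OF degree_one_like_reg_seq reg_seq_bound reg_seq_LIMSEQ])

lemma fourier_coeff_reg_seq_LIMSEQ:
  assumes "1 \<le> p"
  shows "(\<lambda>n. fourier_coeff d (reg_seq p n) \<alpha>) \<longlonglongrightarrow> fourier_coeff d (power_form p) \<alpha>"
  unfolding fourier_coeff_eq_inner
proof (rule L2_inner_LIMSEQ[OF _ reg_seq_bound[OF assms] reg_seq_LIMSEQ L2_character])
  show "reg_seq p n \<in> borel_measurable (torus_haar d)" for n
    using degree_one_like_reg_seq[of p n] by (simp add: degree_one_like_def L2_torus_def)
qed

text \<open>Uniform in n; through \<open>fourier_coeff_reg\<close> it becomes the uniform bound on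
  the area integrals that Fatou's lemma needs.\<close>

lemma norm_fourier_coeff_reg_seq:
  assumes "1 \<le> p"
  shows "cmod (fourier_coeff d (reg_seq p n) \<alpha>) \<le> (M\<^sup>2 + 1) powr ((p - 2) / 2 + 1/2)"
proof -
  have "cmod (fourier_coeff d (reg_seq p n) \<alpha>) \<le> (LINT z|torus_haar d. cmod (reg_seq p n z * cnj (character d \<alpha> z)))"
    unfolding fourier_coeff_eq_inner L2_inner_def by (rule integral_norm_bound)
  also have "\<dots> \<le> (LINT z|torus_haar d. (M\<^sup>2 + 1) powr ((p - 2) / 2 + 1/2))"
  proof (rule integral_mono)
    show "integrable (torus_haar d) (\<lambda>z. cmod (reg_seq p n z * cnj (character d \<alpha> z)))"
      using degree_one_like_reg_seq[of p n]
      by (intro integrable_norm L2_integrable_mult L2_character) (simp add: degree_one_like_def)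
  qed (use reg_seq_bound[OF assms] in \<open>auto simp: norm_mult norm_character\<close>)
  finally show ?thesis by (simp add: torus_haar.prob_space)
qed

text \<open>No estimate of \<psi> near its zeros is made: the bound on the singular integral comes
  from the bounded Fourier coefficients, after division by |c_j|. The integrable limit Y then
  majorises the whole sequence, up to a constant, and the formula itself passes to the
  limit.\<close>

lemma
  assumes p: "1 \<le> p" and j: "j \<in> {1..d}" and c: "c j \<noteq> 0"
  shows integrable_\<psi>_powr:
      "integrable (torus_haar d \<Otimes>\<^sub>M unit_interval) (\<lambda>x. cmod (\<psi> j x) powr (p - 2) * (2 * snd x))" (is ?int)
    and fourier_coeff_power_form_pair: "fourier_coeff d (power_form p) (unit_index j) = of_real (p / 2) * (c j *
      of_real (LINT x|(torus_haar d \<Otimes>\<^sub>M unit_interval). cmod (\<psi> j x) powr (p - 2) * (2 * snd x)))" (is ?eq)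
proof -
  define T where "T = torus_haar d \<Otimes>\<^sub>M unit_interval"
  define a where "a = (p - 2) / 2"
  have a: "a \<ge> -1/2" "2 * a = p - 2" "1 + a = p / 2" using p by (auto simp: a_def field_simps)
  define B where "B = (M\<^sup>2 + 1) powr (a + 1/2)"
  define X where "X n x = dreg (1 / Suc n) a (\<psi> j x) * (2 * snd x)" for n x
  define Y where "Y x = cmod (\<psi> j x) powr (p - 2) * (2 * snd x)" for x
  have [measurable]: "\<psi> j \<in> borel_measurable T" "(\<lambda>x. snd x) \<in> borel_measurable T"
    unfolding T_def by (rule measurable_\<psi>[OF j], measurable)
  have Xint: "integrable T (X n)" for n
    unfolding X_def[abs_def] T_def by (rule integrable_dreg_\<psi>[OF _ j]) simp
  have Xm [measurable]: "X n \<in> borel_measurable T" for n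
    using Xint by (rule borel_measurable_integrable)
  have Ym [measurable]: "Y \<in> borel_measurable T"
    unfolding Y_def[abs_def] by measurable
  have r: "0 \<le> snd x" "snd x \<le> 1" if "x \<in> space T" for x
    using that by (auto simp: T_def space_pair_measure space_restrict_space)
  have X0: "X n x \<ge> 0" if "x \<in> space T" for n x
    unfolding X_def using r[OF that] a by (intro mult_nonneg_nonneg dreg_nonneg) auto
  have Y0: "Y x \<ge> 0" if "x \<in> space T" for x
    unfolding Y_def using r[OF that] by auto
  have nz: "AE x in T. \<psi> j x \<noteq> 0"
    unfolding T_def by (rule AE_\<psi>_nonzero[OF j c])
  have lim: "AE x in T. (\<lambda>n. X n x) \<longlonglongrightarrow> p / 2 * Y x"
    using nz
  proof eventually_elim
    case (elim x)
    have "(\<lambda>n. X n x) \<longlonglongrightarrow> (1 + a) * cmod (\<psi> j x) powr (2 * a) * (2 * snd x)"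
      unfolding X_def by (intro tendsto_mult_right dreg_LIMSEQ[OF one_over_Suc_LIMSEQ elim])
    then show ?case by (simp only: Y_def a mult.assoc)
  qed
  have coeff: "fourier_coeff d (reg_seq p n) (unit_index j) = c j * of_real (integral\<^sup>L T (X n))" for n
    using fourier_coeff_reg[OF _ j, of "1 / Suc n" a]
    unfolding reg_seq_def[abs_def] a_def[symmetric] X_def[abs_def] T_def by simp
  have Xbound: "integral\<^sup>L T (X n) \<le> B / cmod (c j)" for n
  proof -
    have "cmod (c j) * \<bar>integral\<^sup>L T (X n)\<bar> \<le> B"
      using norm_fourier_coeff_reg_seq[OF p, of n "unit_index j"] unfolding coeff B_def a_def
      by (simp add: norm_mult)
    then have "\<bar>integral\<^sup>L T (X n)\<bar> \<le> B / cmod (c j)"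
      using c by (simp add: field_simps)
    then show ?thesis by linarith
  qed
  have "integrable T (\<lambda>x. p / 2 * Y x)"
  proof (rule integrableI_nonneg)
    show "AE x in T. 0 \<le> p / 2 * Y x" using Y0 p by (auto intro!: AE_I2)
    have "(\<integral>\<^sup>+x. ennreal (p / 2 * Y x) \<partial>T) = (\<integral>\<^sup>+x. liminf (\<lambda>n. ennreal (X n x)) \<partial>T)"
    proof (rule nn_integral_cong_AE)
      show "AE x in T. ennreal (p / 2 * Y x) = liminf (\<lambda>n. ennreal (X n x))"
        using lim
      proof eventually_elim
        case (elim x)
        then have "(\<lambda>n. ennreal (X n x)) \<longlonglongrightarrow> ennreal (p / 2 * Y x)"
          by (rule tendsto_ennrealI)
        then show ?case by (simp add: lim_imp_Liminf)
      qed
    qed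
    also have "\<dots> \<le> liminf (\<lambda>n. \<integral>\<^sup>+x. ennreal (X n x) \<partial>T)"
      by (rule nn_integral_liminf) measurable
    also have "\<dots> \<le> liminf (\<lambda>n. ennreal (B / cmod (c j)))"
    proof (rule Liminf_mono, rule always_eventually, rule allI)
      fix n
      have "(\<integral>\<^sup>+x. ennreal (X n x) \<partial>T) = ennreal (integral\<^sup>L T (X n))"
        by (rule nn_integral_eq_integral[OF Xint]) (auto intro!: AE_I2 X0)
      also have "\<dots> \<le> ennreal (B / cmod (c j))" by (rule ennreal_leI[OF Xbound])
      finally show "(\<integral>\<^sup>+x. ennreal (X n x) \<partial>T) \<le> ennreal (B / cmod (c j))" .
    qed
    also have "\<dots> < \<infinity>" by (simp add: Liminf_const)
    finally show "(\<integral>\<^sup>+x. ennreal (p / 2 * Y x) \<partial>T) < \<infinity>" .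
  qed measurable
  then have "integrable T (\<lambda>x. 2 / p * (p / 2 * Y x))" by (rule integrable_mult_right)
  then have Yint: "integrable T Y" using p by simp
  then show ?int by (simp add: T_def Y_def[abs_def])
  \<comment> \<open>K is the second summand of \<open>dreg_le\<close> with
    \<open>1 + a = p / 2\<close>; the factor 2 in the majorant bounds
    \<open>2 * snd x\<close>.\<close>
  define K where "K = p / 2 * (M\<^sup>2 + 1) powr a"
  have "(\<lambda>n. integral\<^sup>L T (X n)) \<longlonglongrightarrow> (LINT x|T. p / 2 * Y x)"
  proof (rule integral_dominated_convergence[OF _ _ _ lim])
    show "integrable T (\<lambda>x. Y x + K * 2)"
      using Yint unfolding T_def by simp
    show "AE x in T. norm (X n x) \<le> Y x + K * 2" for n
      using nz AE_space
    proof eventually_elim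
      case (elim x)
      have "cmod (\<psi> j x) \<le> M" using norm_\<psi> elim by (simp add: T_def)
      then have "dreg (1 / Suc n) a (\<psi> j x) \<le> cmod (\<psi> j x) powr (p - 2) + K"
        using dreg_le[of "1 / Suc n" a "\<psi> j x" M] elim a by (simp add: K_def)
      then have "X n x \<le> (cmod (\<psi> j x) powr (p - 2) + K) * (2 * snd x)"
        unfolding X_def using r[OF elim(2)] by (intro mult_right_mono) auto
      also have "\<dots> = Y x + K * (2 * snd x)" by (simp add: Y_def algebra_simps)
      also have "\<dots> \<le> Y x + K * 2"
        using r[OF elim(2)] p by (intro add_left_mono mult_left_mono) (auto simp: K_def)
      finally show ?case using X0[OF elim(2)] by simp
    qed
  qed measurable
  then have "(\<lambda>n. fourier_coeff d (reg_seq p n) (unit_index j)) \<longlonglongrightarrow> c j * of_real (LINT x|T. p / 2 * Y x)"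
    unfolding coeff by (intro tendsto_intros)
  with fourier_coeff_reg_seq_LIMSEQ[OF p]
  have "fourier_coeff d (power_form p) (unit_index j) = c j * of_real (LINT x|T. p / 2 * Y x)"
    by (rule LIMSEQ_unique)
  also have "(LINT x|T. p / 2 * Y x) = p / 2 * integral\<^sup>L T Y"
    by (rule integral_mult_right_zero)
  finally show ?eq by (simp only: T_def Y_def[abs_def] of_real_mult mult_ac)
qed

lemma fourier_coeff_power_form:
  assumes p: "1 \<le> p" and j: "j \<in> {1..d}"
  shows "fourier_coeff d (power_form p) (unit_index j) = of_real (p / 2) * (c j *
      of_real (LINT r:{0..1}|lborel. (LINT \<zeta>|torus_haar d. cmod (\<psi> j (\<zeta>, r)) powr (p - 2)) * (2 * r)))"
proof (cases "c j = 0")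
  \<comment> \<open>The power of |\<psi>| may fail to be integrable in this case, but the factor
    \<open>c j\<close> annihilates the right side whatever value the integral takes.\<close>
  case True
  have "fourier_coeff d (reg_seq p n) (unit_index j) = 0" for n
    unfolding reg_seq_def[abs_def] using True by (subst fourier_coeff_reg[OF _ j]) auto
  then have "fourier_coeff d (power_form p) (unit_index j) = 0"
    using LIMSEQ_unique[OF fourier_coeff_reg_seq_LIMSEQ[OF p, of "unit_index j"]] by simp
  then show ?thesis using True by simp
next
  case False
  let ?f = "\<lambda>\<zeta> r. cmod (\<psi> j (\<zeta>, r)) powr (p - 2) * (2 * r)"
  have "integrable (torus_haar d \<Otimes>\<^sub>M unit_interval) (case_prod ?f)"
    using integrable_\<psi>_powr[OF p j False] by (simp add: split_beta')
  from torus_interval.integral_snd[OF this]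
  have "(LINT x|(torus_haar d \<Otimes>\<^sub>M unit_interval). cmod (\<psi> j x) powr (p - 2) * (2 * snd x)) =
    (LINT r|unit_interval. (LINT \<zeta>|torus_haar d. cmod (\<psi> j (\<zeta>, r)) powr (p - 2)) * (2 * r))"
    by (simp add: split_beta')
  then show ?thesis
    unfolding fourier_coeff_power_form_pair[OF p j False] integral_unit_interval by (simp only:)
qed

end

theorem theorem1p2:
  fixes p :: real and d :: nat and c :: "nat \<Rightarrow> complex"
    and \<phi> :: "(nat \<Rightarrow> complex) \<Rightarrow> complex"
    and \<phi>\<^sub>j :: "nat \<Rightarrow> (nat \<Rightarrow> complex) \<Rightarrow> real \<Rightarrow> complex"
  assumes "1 \<le> p" and "d \<ge> 1"
    and "\<And>z. \<phi> z = (\<Sum>j=1..d. c j * z j)"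
    and "\<And>j z r. \<phi>\<^sub>j j z r = \<phi> (z(j := complex_of_real r * z j))"
  shows "AE z in torus_haar d.
           riesz_projection d (\<lambda>w. complex_of_real (cmod (\<phi> w) powr (p - 2)) * \<phi> w) z =
           complex_of_real (p / 2) *
             (\<Sum>j=1..d. c j * z j *
                complex_of_real
                  (LINT r:{0..1}|lborel.
                     (LINT \<zeta>|torus_haar d. cmod (\<phi>\<^sub>j j \<zeta> r) powr (p - 2)) * (2 * r)))"
proof -
  interpret linear_form d c \<phi> by standard (rule assms(3))
  have \<psi>: "\<psi> j (\<zeta>, r) = \<phi>\<^sub>j j \<zeta> r" for j \<zeta> r
    by (simp add: \<psi>_def assms(4))
  have coeff: "(\<Sum>j=1..d. fourier_coeff d (power_form p) (unit_index j) * z j) =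
      complex_of_real (p / 2) *
             (\<Sum>j=1..d. c j * z j *
                complex_of_real
                  (LINT r:{0..1}|lborel.
                     (LINT \<zeta>|torus_haar d. cmod (\<phi>\<^sub>j j \<zeta> r) powr (p - 2)) * (2 * r)))" for z
    unfolding sum_distrib_left
    by (intro sum.cong refl, subst fourier_coeff_power_form[OF assms(1)]) (simp_all only: \<psi> mult_ac)
  show ?thesis
    using riesz_projection_degree_one_like[OF degree_one_like_power_form[OF assms(1)]]
    unfolding coeff unfolding power_form_def[abs_def] .
qed

end
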